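(* Let $\mathcal H$ be a separable complex Hilbert space, $H_0\ge 0$ a self-adjoint operator in $\mathcal H$, and $\mathcal H_{+1}(H_0)\subset\mathcal H\subset\mathcal H_{-1}(H_0)$ the associated scale of spaces. Let $V:\mathcal H_{+1}(H_0)\to\mathcal H_{-1}(H_0)$ be a bounded linear operator, and put $$A_V(z):=-(H_0-zI_{\mathcal H})^{-1/2}\,V\,(H_0-zI_{\mathcal H})^{-1/2},\quad z\in\rho(H_0).$$ Assume that $A_V(z)$ is a compact operator on $\mathcal H$ for some (hence, all) $z\in\rho(H_0)$ and that $\|A_V(E_0)\|_{\mathcal B(\mathcal H)}<1$ for some $E_0\in(-\infty,0)$. Let $H$ be the densely defined, closed operator in $\mathcal H$ uniquely determined by $$(H-zI_{\mathcal H})^{-1}=(H_0-zI_{\mathcal H})^{-1/2}[I_{\mathcal H}-A_V(z)]^{-1}(H_0-zI_{\mathcal H})^{-1/2}$$ for all $z\in\rho(H_0)$ with $1\in\rho(A_V(z))$. Let $\lambda_0\in\rho(H_0)$. Then: If $Hf=\lambda_0 f$ for some $0\ne f\in\operatorname{dom}(H)$, then $A_V(\lambda_0)g=g$, where $0\neq g=(H_0-\lambda_0I_{\mathcal H})^{1/2}f$. Conversely, if $A_V(\lambda_0)g=g$ for some $0\ne g\in\mathcal H$, then $Hf=\lambda_0f$, where $0\ne f=(H_0-\lambda_0I_{\mathcal H})^{-1/2}g\in\operatorname{dom}(H)$. Moreover, $$\dim(\ker(H-\lambda_0I_{\mathcal H}))=\dim(\ker(I_{\mathcal H}-A_V(\lambda_0)))<\infty,$$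 that is, the geometric multiplicity of $\lambda_0$ as an eigenvalue of $H$ coincides with the geometric multiplicity of the eigenvalue $1$ of $A_V(\lambda_0)$. In particular, for $z\in\rho(H_0)$, one has $z\in\rho(H)$ if and only if $1\in\rho(A_V(z))$.
   Context: Inner products are linear in the second argument; $\rho(\cdot)$ denotes the resolvent set. The complex square root is fixed by $z^{1/2}=|z|^{1/2}e^{i\arg(z)/2}$, $\arg(z)\in[0,2\pi)$, $0^{1/2}=0$. With $E_{H_0}$ the spectral family of $H_0$, $(H_0-zI_{\mathcal H})^{1/2}=\int_{\sigma(H_0)}(\lambda-z)^{1/2}\,dE_{H_0}(\lambda)$ for $z\in\mathbb C$ (with domain $\operatorname{dom}(H_0^{1/2})$) and $(H_0-zI_{\mathcal H})^{-1/2}=\int_{\sigma(H_0)}(\lambda-z)^{-1/2}\,dE_{H_0}(\lambda)$ for $z\in\rho(H_0)$. $\mathcal H_{+1}(H_0)=\operatorname{dom}(H_0^{1/2})$ is a Hilbert space with inner product $(f,g)_{\mathcal H_{+1}(H_0)}=(H_0^{1/2}f,H_0^{1/2}g)_{\mathcal H}+(f,g)_{\mathcal H}$. $\mathcal H_{-1}(H_0)=[\mathcal H_{+1}(H_0)]^*$ is the conjugate dual, i.e., the space of bounded conjugate linear functionals on $\mathcal H_{+1}(H_0)$, with pairing $\langle g,\Psi\rangle=\Psi(g)$ for $g\in\mathcal H_{+1}(H_0)$, $\Psi\in\mathcal H_{-1}(H_0)$. $\mathcal H$ is regarded as a subspace of $\mathcal H_{-1}(H_0)$ by identifying $f\in\mathcal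 H$ with $\Psi_f$, $\Psi_f(g)=(g,f)_{\mathcal H}$. For $z\in\rho(H_0)$, $(H_0-zI_{\mathcal H})^{-1/2}$ maps $\mathcal H$ boundedly into $\mathcal H_{+1}(H_0)$. It also extends to a bounded operator $\mathcal H_{-1}(H_0)\to\mathcal H$, denoted by the same symbol: for $\Psi\in\mathcal H_{-1}(H_0)$, $(H_0-zI_{\mathcal H})^{-1/2}\Psi$ is the unique $f_\Psi\in\mathcal H$ with $(g,f_\Psi)_{\mathcal H}=\langle [(H_0-zI_{\mathcal H})^{-1/2}]^*g,\Psi\rangle$ for all $g\in\mathcal H$. In $A_V(z)$ the right factor is the map $\mathcal H\to\mathcal H_{+1}(H_0)$ and the left factor is this extension $\mathcal H_{-1}(H_0)\to\mathcal H$, so $A_V(z)\in\mathcal B(\mathcal H)$. Existence and uniqueness of the densely defined closed operator $H$ with the stated resolvent is known under the stated assumptions; moreover $\operatorname{dom}(H)\subseteq\operatorname{dom}(H_0^{1/2})$. *)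

theory Defs
  imports "HOL-Analysis.Analysis"
begin

section \<open>Complex Hilbert spaces\<close>

text \<open>
  Complex Hilbert spaces, with the inner product linear in the \<^emph>\<open>second\<close> argument.
  Completeness, and the compatibility of topology and norm, come from the class \<^class>\<open>banach\<close>.
\<close>

class chilbert_space = banach +
  fixes scaleC :: "complex \<Rightarrow> 'a \<Rightarrow> 'a"  (infixr \<open>*\<^sub>C\<close> 75)
    and cinner :: "'a \<Rightarrow> 'a \<Rightarrow> complex"
  assumes scaleC_add_right: "c *\<^sub>C (x + y) = c *\<^sub>C x + c *\<^sub>C y"
    and scaleC_add_left: "(c + d) *\<^sub>C x = c *\<^sub>C x + d *\<^sub>C x"
    and scaleC_scaleC: "c *\<^sub>C d *\<^sub>C x = (c * d) *\<^sub>C x"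
    and scaleR_eq_scaleC: "r *\<^sub>R x = complex_of_real r *\<^sub>C x"
    and cinner_commute: "cinner x y = cnj (cinner y x)"
    and cinner_add_right: "cinner x (y + z) = cinner x y + cinner x z"
    and cinner_scaleC_right: "cinner x (c *\<^sub>C y) = c * cinner x y"
    and norm_eq_sqrt_cinner: "norm x = sqrt (Re (cinner x x))"

lemma scaleC_one: "1 *\<^sub>C x = (x::'a::chilbert_space)"
  using scaleR_eq_scaleC[of 1 x] by simp

global_interpretation complex_vector:
  vector_space "scaleC :: complex \<Rightarrow> 'a \<Rightarrow> 'a::chilbert_space"
  defines cspan = complex_vector.span
    and cdim = complex_vector.dim
  by unfold_locales (simp_all add: scaleC_add_right scaleC_add_left scaleC_scaleC scaleC_one)

text \<open>The library dimension \<^term>\<open>cdim\<close> takes the junk value \<open>0\<close> on infinite-dimensional subspaces,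
  so finiteness of the dimension is a separate predicate.\<close>

definition finite_cdim :: "'a::chilbert_space set \<Rightarrow> bool" where
  "finite_cdim S \<longleftrightarrow> (\<exists>B. finite B \<and> S \<subseteq> cspan B)"


section \<open>Bounded and unbounded operators\<close>

definition bounded_clinear :: "('a::chilbert_space \<Rightarrow> 'b::chilbert_space) \<Rightarrow> bool" where
  "bounded_clinear T \<longleftrightarrow> bounded_linear T \<and> (\<forall>c x. T (c *\<^sub>C x) = c *\<^sub>C T x)"

definition compact_op :: "('a::chilbert_space \<Rightarrow> 'b::chilbert_space) \<Rightarrow> bool" where
  "compact_op T \<longleftrightarrow> bounded_clinear T \<and> (\<forall>B. bounded B \<longrightarrow> compact (closure (T ` B)))"

text \<open>
  A partially defined operator is identified with its graph; its domain is the library's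
  \<^const>\<open>Domain\<close>, and it is a closed operator iff the graph is \<^const>\<open>closed\<close> in the product topology.
\<close>

type_synonym 'a operator = "('a \<times> 'a) set"

definition graph :: "('a \<Rightarrow> 'a) \<Rightarrow> 'a operator" where
  "graph T = {(x, T x) | x. True}"

definition op_app :: "'a operator \<Rightarrow> 'a \<Rightarrow> 'a" where
  "op_app T x = (THE y. (x, y) \<in> T)"

definition linear_op :: "'a::chilbert_space operator \<Rightarrow> bool" where
  "linear_op T \<longleftrightarrow> single_valued T \<and> (0, 0) \<in> T \<and>
     (\<forall>x y x' y'. (x, y) \<in> T \<longrightarrow> (x', y') \<in> T \<longrightarrow> (x + x', y + y') \<in> T) \<and>
     (\<forall>c x y. (x, y) \<in> T \<longrightarrow> (c *\<^sub>C x, c *\<^sub>C y) \<in> T)"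

definition densely_defined :: "'a::chilbert_space operator \<Rightarrow> bool" where
  "densely_defined T \<longleftrightarrow> closure (Domain T) = UNIV"

text \<open>\<open>op_shift T z\<close> is \<open>T - z I\<close>, and \<open>op_comp S T\<close> is \<open>S T\<close> (first \<open>T\<close>, then \<open>S\<close>).\<close>

definition op_shift :: "'a::chilbert_space operator \<Rightarrow> complex \<Rightarrow> 'a operator" where
  "op_shift T z = {(x, y - z *\<^sub>C x) | x y. (x, y) \<in> T}"

definition op_comp :: "'a operator \<Rightarrow> 'a operator \<Rightarrow> 'a operator" where
  "op_comp S T = T O S"

definition op_inv :: "'a operator \<Rightarrow> 'a operator" where
  "op_inv T = T\<inverse>"

definition op_ker :: "'a::chilbert_space operator \<Rightarrow> 'a set" where
  "op_ker T = {x. (x, 0) \<in> T}"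

definition op_adj :: "'a::chilbert_space operator \<Rightarrow> 'a operator" where
  "op_adj T = {(g, h). \<forall>(f, k) \<in> T. cinner g k = cinner h f}"

definition self_adjoint :: "'a::chilbert_space operator \<Rightarrow> bool" where
  "self_adjoint T \<longleftrightarrow> linear_op T \<and> densely_defined T \<and> op_adj T = T"

definition nonneg_op :: "'a::chilbert_space operator \<Rightarrow> bool" where
  "nonneg_op T \<longleftrightarrow> (\<forall>(f, h) \<in> T. cinner f h \<in> \<real> \<and> 0 \<le> Re (cinner f h))"

definition resolvent_set :: "'a::chilbert_space operator \<Rightarrow> complex set" where
  "resolvent_set T = {z. \<exists>B. bounded_clinear B \<and> op_inv (op_shift T z) = graph B}"

definition spectrum :: "'a::chilbert_space operator \<Rightarrow> complex set" where
  "spectrum T = - resolvent_set T"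

definition geometric_multiplicity :: "'a::chilbert_space operator \<Rightarrow> complex \<Rightarrow> nat" where
  "geometric_multiplicity T z = cdim (op_ker (op_shift T z))"


section \<open>Spectral families and spectral integrals\<close>

text \<open>A strongly right-continuous family of orthogonal projections \<open>E(\<lambda>) = E((-\<infinity>, \<lambda>])\<close>.\<close>

definition spectral_family :: "(real \<Rightarrow> 'a::chilbert_space \<Rightarrow> 'a) \<Rightarrow> bool" where
  "spectral_family E \<longleftrightarrow>
     (\<forall>t. bounded_clinear (E t)) \<and>
     (\<forall>t x y. cinner x (E t y) = cinner (E t x) y) \<and>
     (\<forall>s t x. E s (E t x) = E (min s t) x) \<and>
     (\<forall>t x. ((\<lambda>s. E s x) \<longlongrightarrow> E t x) (at_right t)) \<and>
     (\<forall>x. ((\<lambda>s. E s x) \<longlongrightarrow> 0) at_bot) \<and>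
     (\<forall>x. ((\<lambda>s. E s x) \<longlongrightarrow> x) at_top)"

text \<open>The Stieltjes measure \<open>d(f, E(\<lambda>) f)\<close>, and by polarization the integral of \<open>\<phi>\<close> over \<open>S\<close>
  with respect to the complex measure \<open>d(g, E(\<lambda>) f)\<close>.\<close>

definition spectral_measure :: "(real \<Rightarrow> 'a::chilbert_space \<Rightarrow> 'a) \<Rightarrow> 'a \<Rightarrow> real measure" where
  "spectral_measure E f = interval_measure (\<lambda>t. Re (cinner f (E t f)))"

definition spectral_form ::
    "(real \<Rightarrow> 'a::chilbert_space \<Rightarrow> 'a) \<Rightarrow> real set \<Rightarrow> (real \<Rightarrow> complex) \<Rightarrow> 'a \<Rightarrow> 'a \<Rightarrow> complex" where
  "spectral_form E S \<phi> g f =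
     (\<Sum>k<4. \<i> ^ k * (LINT t:S|spectral_measure E (f + \<i> ^ k *\<^sub>C g). \<phi> t)) / 4"

definition spectral_dom ::
    "(real \<Rightarrow> 'a::chilbert_space \<Rightarrow> 'a) \<Rightarrow> real set \<Rightarrow> (real \<Rightarrow> complex) \<Rightarrow> 'a set" where
  "spectral_dom E S \<phi> = {f. set_integrable (spectral_measure E f) S (\<lambda>t. (cmod (\<phi> t))\<^sup>2)}"

text \<open>The operator \<open>\<integral>\<^sub>S \<phi>(\<lambda>) dE(\<lambda>)\<close>. As its domain is dense, the second component
  is determined by the first.\<close>

definition spectral_integral ::
    "(real \<Rightarrow> 'a::chilbert_space \<Rightarrow> 'a) \<Rightarrow> real set \<Rightarrow> (real \<Rightarrow> complex) \<Rightarrow> 'a operator" where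
  "spectral_integral E S \<phi> =
     {(f, h). f \<in> spectral_dom E S \<phi> \<and>
        (\<forall>g \<in> spectral_dom E S \<phi>. cinner g h = spectral_form E S \<phi> g f)}"

definition spectral_family_of ::
    "(real \<Rightarrow> 'a::chilbert_space \<Rightarrow> 'a) \<Rightarrow> 'a operator \<Rightarrow> bool" where
  "spectral_family_of E H0 \<longleftrightarrow>
     spectral_family E \<and> H0 = spectral_integral E UNIV complex_of_real"


section \<open>Square roots of \<open>H\<^sub>0 - z\<close>\<close>

text \<open>The branch with argument in \<open>[0, 2 \<pi>)\<close>; this differs from \<^const>\<open>csqrt\<close>
  on the open lower half-plane.\<close>

definition zsqrt :: "complex \<Rightarrow> complex" where
  "zsqrt z = of_real (sqrt (cmod z)) * exp (\<i> * of_real (Arg2pi z / 2))"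

definition real_spectrum :: "'a::chilbert_space operator \<Rightarrow> real set" where
  "real_spectrum H0 = {t. complex_of_real t \<in> spectrum H0}"

text \<open>In what follows \<open>E\<close> is meant to be the spectral family of \<open>H0\<close>.\<close>

definition sqrt_op ::
    "'a::chilbert_space operator \<Rightarrow> (real \<Rightarrow> 'a \<Rightarrow> 'a) \<Rightarrow> complex \<Rightarrow> 'a operator" where
  "sqrt_op H0 E z =
     spectral_integral E (real_spectrum H0) (\<lambda>t. zsqrt (complex_of_real t - z))"

definition inv_sqrt_op ::
    "'a::chilbert_space operator \<Rightarrow> (real \<Rightarrow> 'a \<Rightarrow> 'a) \<Rightarrow> complex \<Rightarrow> 'a operator" where
  "inv_sqrt_op H0 E z =
     spectral_integral E (real_spectrum H0) (\<lambda>t. inverse (zsqrt (complex_of_real t - z)))"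


section \<open>The scale of spaces\<close>

definition Hplus :: "'a::chilbert_space operator \<Rightarrow> (real \<Rightarrow> 'a \<Rightarrow> 'a) \<Rightarrow> 'a set" where
  "Hplus H0 E = Domain (sqrt_op H0 E 0)"

definition Hplus_inner ::
    "'a::chilbert_space operator \<Rightarrow> (real \<Rightarrow> 'a \<Rightarrow> 'a) \<Rightarrow> 'a \<Rightarrow> 'a \<Rightarrow> complex" where
  "Hplus_inner H0 E f g =
     cinner (op_app (sqrt_op H0 E 0) f) (op_app (sqrt_op H0 E 0) g) + cinner f g"

definition Hplus_norm ::
    "'a::chilbert_space operator \<Rightarrow> (real \<Rightarrow> 'a \<Rightarrow> 'a) \<Rightarrow> 'a \<Rightarrow> real" where
  "Hplus_norm H0 E f = sqrt (Re (Hplus_inner H0 E f f))"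

text \<open>A functional on \<^term>\<open>Hplus H0 E\<close> is represented by the function on the whole type that
  is \<open>0\<close> off \<^term>\<open>Hplus H0 E\<close>; the linear structure is then the pointwise one.\<close>

definition Hminus ::
    "'a::chilbert_space operator \<Rightarrow> (real \<Rightarrow> 'a \<Rightarrow> 'a) \<Rightarrow> ('a \<Rightarrow> complex) set" where
  "Hminus H0 E = {\<Psi>.
     (\<forall>g. g \<notin> Hplus H0 E \<longrightarrow> \<Psi> g = 0) \<and>
     (\<forall>f \<in> Hplus H0 E. \<forall>g \<in> Hplus H0 E. \<Psi> (f + g) = \<Psi> f + \<Psi> g) \<and>
     (\<forall>c. \<forall>g \<in> Hplus H0 E. \<Psi> (c *\<^sub>C g) = cnj c * \<Psi> g) \<and>
     (\<exists>C. \<forall>g \<in> Hplus H0 E. cmod (\<Psi> g) \<le> C * Hplus_norm H0 E g)}"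

definition Hminus_norm ::
    "'a::chilbert_space operator \<Rightarrow> (real \<Rightarrow> 'a \<Rightarrow> 'a) \<Rightarrow> ('a \<Rightarrow> complex) \<Rightarrow> real" where
  "Hminus_norm H0 E \<Psi> = (SUP g \<in> {g \<in> Hplus H0 E. Hplus_norm H0 E g \<le> 1}. cmod (\<Psi> g))"

definition bounded_Hplus_Hminus ::
    "'a::chilbert_space operator \<Rightarrow> (real \<Rightarrow> 'a \<Rightarrow> 'a) \<Rightarrow> ('a \<Rightarrow> 'a \<Rightarrow> complex) \<Rightarrow> bool" where
  "bounded_Hplus_Hminus H0 E V \<longleftrightarrow>
     (\<forall>f \<in> Hplus H0 E. V f \<in> Hminus H0 E) \<and>
     (\<forall>f \<in> Hplus H0 E. \<forall>g \<in> Hplus H0 E. V (f + g) = (\<lambda>h. V f h + V g h)) \<and>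
     (\<forall>c. \<forall>f \<in> Hplus H0 E. V (c *\<^sub>C f) = (\<lambda>h. c * V f h)) \<and>
     (\<exists>C. \<forall>f \<in> Hplus H0 E. Hminus_norm H0 E (V f) \<le> C * Hplus_norm H0 E f)"

text \<open>The extension of \<open>(H\<^sub>0 - z)\<^sup>-\<^sup>1\<^sup>/\<^sup>2\<close> to \<^term>\<open>Hminus H0 E\<close>.\<close>

definition inv_sqrt_ext ::
    "'a::chilbert_space operator \<Rightarrow> (real \<Rightarrow> 'a \<Rightarrow> 'a) \<Rightarrow> complex \<Rightarrow> ('a \<Rightarrow> complex) \<Rightarrow> 'a" where
  "inv_sqrt_ext H0 E z \<Psi> =
     (THE f. \<forall>g. cinner g f = \<Psi> (op_app (op_adj (inv_sqrt_op H0 E z)) g))"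

definition A_op ::
    "'a::chilbert_space operator \<Rightarrow> (real \<Rightarrow> 'a \<Rightarrow> 'a) \<Rightarrow> ('a \<Rightarrow> 'a \<Rightarrow> complex) \<Rightarrow> complex \<Rightarrow> 'a \<Rightarrow> 'a" where
  "A_op H0 E V z f = - inv_sqrt_ext H0 E z (V (op_app (inv_sqrt_op H0 E z) f))"

end

theory Submission
  imports Defs "HOL-Probability.Distribution_Functions"
begin

text \<open>
  Let \<open>r(z) = (H0 - z)\<^sup>-\<^sup>1\<^sup>/\<^sup>2\<close>, a bounded injective operator with dense range whose inverse is
  \<open>(H0 - z)\<^sup>1\<^sup>/\<^sup>2\<close>. Everything follows from one description of \<open>H\<close>, valid for each \<open>z\<close> in the resolvent set of
  \<open>H0\<close> (lemma \<open>mem_op_shift_H_iff\<close>):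
  \<open>(H - z) f = h\<close> holds if and only if \<open>f = r(z) g\<close> and \<open>(1 - A(z)) g = r(z) h\<close> for some \<open>g\<close>.
  For \<open>h = 0\<close> it says that \<open>r(z)\<close> maps the kernel of \<open>1 - A(z)\<close> bijectively onto the kernel of \<open>H - z\<close>, and the
  former is finite-dimensional because \<open>A(z)\<close> is compact. If \<open>1 - A(z)\<close> is invertible, then so is \<open>H - z\<close>, with
  inverse \<open>r(z) (1 - A(z))\<^sup>-\<^sup>1 r(z)\<close>. If \<open>H - z\<close> is invertible, then \<open>1 - A(z)\<close> is injective and its range contains
  the dense range of \<open>r(z)\<close>; for a compact \<open>A(z)\<close> injectivity makes the range closed, so that \<open>1 - A(z)\<close> is
  invertible.

  The description is derived from the resolvent formula at the single point \<open>e = E\<^sub>0\<close>, where \<open>1 - A(e)\<close> is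
  invertible by the contraction principle. The bounded operators \<open>U = (H0 - e)\<^sup>1\<^sup>/\<^sup>2 (H0 - z)\<^sup>-\<^sup>1\<^sup>/\<^sup>2\<close> satisfy
  \<open>r(z) = r(e) U\<close>, \<open>A(z) = U A(e) U\<close> and \<open>U\<^sup>2 = 1 + (z - e) r(z)\<^sup>2\<close>, and these identities transport the formula from
  \<open>e\<close> to \<open>z\<close>.

  The square roots are spectral integrals, so a functional calculus for a spectral family has to be
  built first. For bounded Borel functions it is obtained from the projections \<open>E t\<close> by bounded limits
  (\<open>bcalc_exists\<close>, \<open>bcalc_mult\<close>); for an unbounded \<open>\<phi>\<close> the spectral integral is the strong limit of the operators of
  the truncations of \<open>\<phi>\<close>, on the vectors where it exists (\<open>mem_spectral_integral_iff\<close>). The resolvent set of \<open>H0\<close>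
  enters through the fact that the real spectrum is the support of \<open>E\<close> (\<open>mem_spectrum_compl_iff\<close>).
\<close>

section \<open>Inner products and the Riesz representation theorem\<close>

lemma cinner_add_left: "cinner (x + y) z = cinner x z + cinner y (z::'a::chilbert_space)"
  by (metis cinner_commute cinner_add_right complex_cnj_add)

lemma cinner_scaleC_left: "cinner (c *\<^sub>C x) y = cnj c * cinner x (y::'a::chilbert_space)"
  by (metis cinner_commute cinner_scaleC_right complex_cnj_mult)

lemma scaleC_minus_one: "(-1) *\<^sub>C x = - (x::'a::chilbert_space)"
  using scaleR_eq_scaleC[of "-1" x] by simp

lemma cinner_minus_right: "cinner x (- y) = - cinner x (y::'a::chilbert_space)"
  using cinner_scaleC_right[of x "-1" y] by (simp add: scaleC_minus_one)

lemma cinner_diff_right: "cinner x (y - z) = cinner x y - cinner x (z::'a::chilbert_space)"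
  using cinner_add_right[of x y "- z"] by (simp add: cinner_minus_right)

lemma cinner_zero_right [simp]: "cinner x (0::'a::chilbert_space) = 0"
  using cinner_add_right[of x 0 0] by simp

lemma cinner_zero_left [simp]: "cinner 0 (x::'a::chilbert_space) = 0"
  using cinner_add_left[of 0 0 x] by simp

lemma cinner_sum_right: "cinner x (\<Sum>i\<in>I. f i) = (\<Sum>i\<in>I. cinner x (f i :: 'a::chilbert_space))"
  by (induction I rule: infinite_finite_induct) (simp_all add: cinner_add_right)

lemma Re_cinner_commute: "Re (cinner x y) = Re (cinner y (x::'a::chilbert_space))"
  by (subst cinner_commute) simp

lemma cinner_self: "cinner x x = of_real ((norm (x::'a::chilbert_space))\<^sup>2)"
proof -
  have "Im (cinner x x) = 0"
    by (metis cinner_commute cnj.simps(2) neg_equal_zero)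
  moreover have "0 \<le> Re (cinner x x)"
    using norm_ge_zero[of x] unfolding norm_eq_sqrt_cinner by simp
  ultimately show ?thesis
    by (simp add: complex_eq_iff norm_eq_sqrt_cinner)
qed

lemma norm_add_sq: "(norm (x + y :: 'a::chilbert_space))\<^sup>2 = (norm x)\<^sup>2 + (norm y)\<^sup>2 + 2 * Re (cinner x y)"
proof -
  have "cinner (x + y) (x + y) = cinner x x + cinner y y + (cinner x y + cinner y x)"
    by (simp add: cinner_add_left cinner_add_right)
  from arg_cong[OF this, of Re] show ?thesis
    using Re_cinner_commute[of x y] by (simp add: cinner_self)
qed

lemma norm_diff_sq: "(norm (x - y :: 'a::chilbert_space))\<^sup>2 = (norm x)\<^sup>2 + (norm y)\<^sup>2 - 2 * Re (cinner x y)"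
  using norm_add_sq[of x "- y"] by (simp add: cinner_minus_right)

lemma norm_scaleC: "norm (c *\<^sub>C x) = cmod c * norm (x::'a::chilbert_space)"
proof -
  have "cinner (c *\<^sub>C x) (c *\<^sub>C x) = (c * cnj c) * cinner x x"
    by (simp add: cinner_scaleC_left cinner_scaleC_right)
  then have "(of_real ((norm (c *\<^sub>C x))\<^sup>2) :: complex) = of_real ((cmod c * norm x)\<^sup>2)"
    by (simp add: cinner_self complex_mult_cnj cmod_power2 power_mult_distrib)
  then have "(norm (c *\<^sub>C x))\<^sup>2 = (cmod c * norm x)\<^sup>2"
    using of_real_eq_iff by blast
  then show ?thesis by (simp add: power2_eq_iff_nonneg)
qed

lemma Re_cinner_le: "Re (cinner x y) \<le> norm x * norm (y::'a::chilbert_space)"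
proof -
  have "(norm (x + y))\<^sup>2 \<le> (norm x + norm y)\<^sup>2"
    by (simp add: norm_triangle_ineq power_mono)
  then show ?thesis by (simp add: norm_add_sq power2_sum)
qed

lemma cauchy_schwarz: "cmod (cinner x y) \<le> norm x * norm (y::'a::chilbert_space)"
proof (cases "cinner x y = 0")
  case False
  define c where "c = cnj (sgn (cinner x y))"
  have "c * cinner x y = of_real (cmod (cinner x y))"
    using False complex_norm_square[of "cinner x y"]
    by (simp add: c_def sgn_div_norm scaleR_conv_of_real field_simps power2_eq_square)
  moreover have "cmod c = 1" using False by (simp add: c_def norm_sgn)
  ultimately show ?thesis
    using Re_cinner_le[of x "c *\<^sub>C y"] by (simp add: cinner_scaleC_right norm_scaleC)
qed simp

lemma cinner_eqI: "(\<And>g. cinner g x = cinner g y) \<Longrightarrow> x = (y::'a::chilbert_space)"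
proof -
  assume "\<And>g. cinner g x = cinner g y"
  then have "cinner (x - y) (x - y) = 0" by (simp add: cinner_diff_right)
  then show "x = y" by (simp add: cinner_self)
qed

lemma bounded_linear_cinner_right: "bounded_linear (cinner (x::'a::chilbert_space))"
  by (rule bounded_linear_intro[where K = "norm x"])
    (auto simp: cinner_add_right scaleR_eq_scaleC cinner_scaleC_right scaleR_conv_of_real
      intro: order_trans[OF cauchy_schwarz] simp: mult.commute)

lemmas tendsto_cinner_right [tendsto_intros] = bounded_linear.tendsto[OF bounded_linear_cinner_right]

lemma tendsto_cinner_left [tendsto_intros]:
  assumes "(f \<longlongrightarrow> l) F"
  shows "((\<lambda>x. cinner (f x) y) \<longlongrightarrow> cinner l (y::'a::chilbert_space)) F"
proof -
  have "((\<lambda>x. cnj (cinner y (f x))) \<longlongrightarrow> cnj (cinner y l)) F"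
    by (intro tendsto_intros assms)
  then show ?thesis by (simp add: cinner_commute[symmetric])
qed

text \<open>A sesquilinear form is determined by its values on the diagonal.\<close>

lemma polarization:
  fixes B :: "'a::chilbert_space \<Rightarrow> 'a \<Rightarrow> complex"
  assumes "\<And>x y z. B (x + y) z = B x z + B y z" and "\<And>x y z. B x (y + z) = B x y + B x z"
    and "\<And>c x y. B (c *\<^sub>C x) y = cnj c * B x y" and "\<And>c x y. B x (c *\<^sub>C y) = c * B x y"
  shows "(\<Sum>k<4. \<i> ^ k * B (f + \<i> ^ k *\<^sub>C g) (f + \<i> ^ k *\<^sub>C g)) / 4 = B g f"
  by (simp add: eval_nat_numeral assms scaleC_one algebra_simps)

text \<open>The representing vector of \<open>l\<close> minimizes \<open>\<parallel>x\<parallel>\<^sup>2 - 2 Re (l x)\<close>: by the parallelogram law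
  minimizing sequences are Cauchy sequences, and the first variation at the minimum vanishes.\<close>

lemma riesz_representation:
  fixes l :: "'a::chilbert_space \<Rightarrow> complex"
  assumes add: "\<And>x y. l (x + y) = l x + l y"
    and scale: "\<And>c x. l (c *\<^sub>C x) = cnj c * l x"
    and bound: "\<And>x. cmod (l x) \<le> C * norm x"
  obtains h where "\<And>g. cinner g h = l g"
proof -
  define J where "J x = (norm x)\<^sup>2 - 2 * Re (l x)" for x
  have scaleR: "l (r *\<^sub>R x) = of_real r * l x" for r x
    by (simp add: scaleR_eq_scaleC scale)
  have lin: "bounded_linear l"
    by (rule bounded_linear_intro[where K = C]) (auto simp: add scaleR scaleR_conv_of_real bound mult.commute)
  have J_ge: "- C\<^sup>2 \<le> J x" for x
  proof -
    have "0 \<le> (norm x - C)\<^sup>2" by simp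
    then have "- C\<^sup>2 \<le> (norm x)\<^sup>2 - 2 * (C * norm x)" by (simp add: power2_diff algebra_simps)
    moreover have "Re (l x) \<le> C * norm x"
      using complex_Re_le_cmod bound order_trans by blast
    ultimately show ?thesis by (simp add: J_def)
  qed
  define m where "m = (INF x. J x)"
  have bdd: "bdd_below (range J)" by (rule bdd_belowI2) (rule J_ge)
  have m_le: "m \<le> J x" for x unfolding m_def by (rule cINF_lower[OF bdd]) simp
  have "\<exists>x. J x < m + inverse (of_nat (Suc n))" for n
    using cINF_less_iff[of UNIV J "m + inverse (of_nat (Suc n))", OF _ bdd] unfolding m_def by auto
  then obtain X where X: "\<And>n. J (X n) < m + inverse (of_nat (Suc n))" by metis
  have par: "(norm (x - y))\<^sup>2 \<le> 2 * (J x - m) + 2 * (J y - m)" for x y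
  proof -
    define z where "z = (1/2) *\<^sub>R (x + y)"
    have "4 * J z = (norm (x + y))\<^sup>2 - 4 * Re (l x + l y)"
      by (simp add: z_def J_def power_mult_distrib power2_eq_square scaleR add add_divide_distrib)
    then have "2 * J x + 2 * J y - 4 * J z = (norm (x - y))\<^sup>2"
      by (simp add: J_def norm_add_sq norm_diff_sq)
    then show ?thesis using m_le[of z] by argo
  qed
  have "Cauchy X"
  proof (rule metric_CauchyI)
    fix e :: real assume "0 < e"
    then obtain N where N: "inverse (of_nat (Suc N)) < e\<^sup>2 / 4"
      using reals_Archimedean[of "e\<^sup>2 / 4"] by auto
    have small: "J (X n) - m < e\<^sup>2 / 4" if "n \<ge> N" for n
    proof -
      have "inverse (of_nat (Suc n)) \<le> (inverse (of_nat (Suc N)) :: real)"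
        using that by (intro le_imp_inverse_le) auto
      then show ?thesis using X[of n] N by linarith
    qed
    have "dist (X i) (X j) < e" if "i \<ge> N" "j \<ge> N" for i j
    proof -
      have "(norm (X i - X j))\<^sup>2 < e\<^sup>2"
        using par[of "X i" "X j"] small[OF that(1)] small[OF that(2)] by argo
      then show ?thesis using \<open>0 < e\<close> by (simp add: dist_norm power_less_imp_less_base)
    qed
    then show "\<exists>N. \<forall>i\<ge>N. \<forall>j\<ge>N. dist (X i) (X j) < e" by blast
  qed
  then obtain h where h: "X \<longlonglongrightarrow> h" using Cauchy_convergent convergent_def by blast
  have Jh: "J h = m"
  proof (rule LIMSEQ_unique)
    show "(\<lambda>n. J (X n)) \<longlonglongrightarrow> J h" unfolding J_def
      by (intro tendsto_intros h bounded_linear.tendsto[OF lin])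
    have "(\<lambda>n. m + inverse (of_nat (Suc n))) \<longlonglongrightarrow> m + 0"
      by (intro tendsto_intros LIMSEQ_inverse_real_of_nat)
    then have lim: "(\<lambda>n. m + inverse (of_nat (Suc n))) \<longlonglongrightarrow> m" by simp
    show "(\<lambda>n. J (X n)) \<longlonglongrightarrow> m"
      using m_le X by (intro tendsto_sandwich[OF always_eventually always_eventually tendsto_const lim])
        (blast intro: less_imp_le)+
  qed
  have Re_eq: "Re (cinner g h) = Re (l g)" for g
  proof (rule ccontr)
    define d where "d = Re (cinner g h) - Re (l g)"
    assume "Re (cinner g h) \<noteq> Re (l g)"
    then have d: "d \<noteq> 0" by (simp add: d_def)
    have var: "0 \<le> t\<^sup>2 * (norm g)\<^sup>2 + 2 * t * d" for t
    proof -
      have "J (h + t *\<^sub>R g) = J h + t\<^sup>2 * (norm g)\<^sup>2 + 2 * t * d"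
        using Re_cinner_commute[of h g]
        by (simp add: J_def norm_add_sq add scaleR d_def scaleR_eq_scaleC cinner_scaleC_right
            norm_scaleC power_mult_distrib scale algebra_simps)
      then show ?thesis using m_le[of "h + t *\<^sub>R g"] Jh by linarith
    qed
    \<comment> \<open>The quadratic in \<open>t\<close> is smallest at \<open>- d / \<parallel>g\<parallel>\<^sup>2\<close>; adding \<open>1\<close> to the denominator also covers \<open>g = 0\<close>.\<close>
    define N where "N = (norm g)\<^sup>2 + 1"
    have N: "0 < N" by (simp add: N_def add_nonneg_pos)
    have "0 \<le> (- d / N)\<^sup>2 * (norm g)\<^sup>2 + 2 * (- d / N) * d" by (rule var)
    also have "\<dots> \<le> (- d / N)\<^sup>2 * N + 2 * (- d / N) * d"
      by (intro add_right_mono mult_left_mono) (auto simp: N_def)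
    also have "\<dots> = - (d\<^sup>2 / N)"
      using N by (simp add: power2_eq_square field_simps)
    finally show False using d N by (simp add: divide_le_0_iff)
  qed
  have "cinner g h = l g" for g
  proof (rule complex_eqI)
    show "Im (cinner g h) = Im (l g)"
      using Re_eq[of "\<i> *\<^sub>C g"] by (simp add: cinner_scaleC_left scale)
  qed (rule Re_eq)
  then show ?thesis using that by blast
qed

section \<open>Bounded Borel functions\<close>

definition bounded_borel :: "(real \<Rightarrow> complex) \<Rightarrow> bool" where
  "bounded_borel \<phi> \<longleftrightarrow> \<phi> \<in> borel_measurable borel \<and> bounded (range \<phi>)"

lemma bounded_borelI: "\<phi> \<in> borel_measurable borel \<Longrightarrow> (\<And>t. cmod (\<phi> t) \<le> M) \<Longrightarrow> bounded_borel \<phi>"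
  unfolding bounded_borel_def bounded_iff by blast

lemma bounded_borel_measurable [measurable_dest]: "bounded_borel \<phi> \<Longrightarrow> \<phi> \<in> borel_measurable borel"
  by (simp add: bounded_borel_def)

lemma bounded_borel_bound:
  assumes "bounded_borel \<phi>"
  obtains M where "0 < M" "\<And>t. cmod (\<phi> t) \<le> M"
  using assms unfolding bounded_borel_def bounded_pos by auto

lemma bounded_borel_add:
  assumes "bounded_borel \<phi>" "bounded_borel \<psi>"
  shows "bounded_borel (\<lambda>t. \<phi> t + \<psi> t)"
proof -
  obtain M N where "\<And>t. cmod (\<phi> t) \<le> M" "\<And>t. cmod (\<psi> t) \<le> N"
    using assms bounded_borel_bound by metis
  then have "cmod (\<phi> t + \<psi> t) \<le> M + N" for t
    by (meson add_mono norm_triangle_ineq order_trans)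
  then show ?thesis
    by (intro bounded_borelI) (use assms in measurable)
qed

lemma bounded_borel_mult:
  assumes "bounded_borel \<phi>" "bounded_borel \<psi>"
  shows "bounded_borel (\<lambda>t. \<phi> t * \<psi> t)"
proof -
  obtain M N where MN: "0 < M" "\<And>t. cmod (\<phi> t) \<le> M" "0 < N" "\<And>t. cmod (\<psi> t) \<le> N"
    using assms bounded_borel_bound by metis
  then have "cmod (\<phi> t * \<psi> t) \<le> M * N" for t
    by (simp add: norm_mult mult_mono')
  then show ?thesis
    by (intro bounded_borelI) (use assms in measurable)
qed

lemma bounded_borel_const [simp]: "bounded_borel (\<lambda>t. c)"
  by (rule bounded_borelI[of _ "cmod c"]) auto

lemma bounded_borel_indicator: "A \<in> sets borel \<Longrightarrow> bounded_borel (indicator A)"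
  by (rule bounded_borelI[of _ 1]) (auto simp: indicator_def)

lemma bounded_borel_cnj: "bounded_borel \<phi> \<Longrightarrow> bounded_borel (\<lambda>t. cnj (\<phi> t))"
proof -
  assume *: "bounded_borel \<phi>"
  then obtain M where "\<And>t. cmod (\<phi> t) \<le> M" using bounded_borel_bound by metis
  with * show ?thesis
    by (intro bounded_borelI[of _ M] measurable_compose[OF _ borel_measurable_continuous_onI[of cnj]])
      (auto intro: continuous_intros bounded_borel_measurable)
qed

lemma bounded_borel_scale: "bounded_borel \<phi> \<Longrightarrow> bounded_borel (\<lambda>t. c * \<phi> t)"
  by (rule bounded_borel_mult) simp

lemma bounded_borel_diff: "bounded_borel \<phi> \<Longrightarrow> bounded_borel \<psi> \<Longrightarrow> bounded_borel (\<lambda>t. \<phi> t - \<psi> t)"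
  using bounded_borel_add[of \<phi> "\<lambda>t. (-1) * \<psi> t"] bounded_borel_scale[of \<psi> "-1"] by simp

text \<open>The half-lines are an intersection-stable generator of the Borel sets. Stability under linear
  combinations and bounded limits turns the sets with property \<open>P\<close> into a Dynkin system, and leads from
  indicators to simple functions and from these to their bounded limits.\<close>

lemma bounded_borel_induct [consumes 1, case_names halfline add scale lim]:
  assumes \<phi>: "bounded_borel \<phi>"
    and halfline: "\<And>t. P (indicator {..t})"
    and add: "\<And>\<phi> \<psi>. bounded_borel \<phi> \<Longrightarrow> bounded_borel \<psi> \<Longrightarrow> P \<phi> \<Longrightarrow> P \<psi> \<Longrightarrow> P (\<lambda>t. \<phi> t + \<psi> t)"
    and scale: "\<And>c \<phi>. bounded_borel \<phi> \<Longrightarrow> P \<phi> \<Longrightarrow> P (\<lambda>t. c * \<phi> t)"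
    and lim: "\<And>F \<phi> M. (\<And>n. bounded_borel (F n)) \<Longrightarrow> (\<And>n. P (F n)) \<Longrightarrow> bounded_borel \<phi> \<Longrightarrow>
      (\<And>n t. cmod (F n t) \<le> M) \<Longrightarrow> (\<And>t. (\<lambda>n. F n t) \<longlonglongrightarrow> \<phi> t) \<Longrightarrow> P \<phi>"
  shows "P \<phi>"
proof -
  have zero: "P (\<lambda>t. 0)"
    using scale[OF bounded_borel_indicator halfline, of 0 0] by simp
  have one: "P (\<lambda>t. 1)"
  proof (rule lim[where F = "\<lambda>n. indicator {..real n}" and M = 1])
    fix t :: real
    obtain N where "t \<le> real N" using real_arch_simple by blast
    then have "\<forall>\<^sub>F n in sequentially. indicator {..real n} t = (1::complex)"
      by (intro eventually_sequentiallyI[of N]) (auto simp: indicator_def)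
    then show "(\<lambda>n. indicator {..real n} t) \<longlonglongrightarrow> (1::complex)" by (rule tendsto_eventually)
  qed (auto intro: halfline bounded_borel_indicator simp: indicator_def)
  have sets: "P (indicator A)" if "A \<in> sets borel" for A :: "real set"
  proof -
    have "Int_stable (range (atMost :: real \<Rightarrow> _))" "range atMost \<subseteq> Pow (UNIV :: real set)"
      "A \<in> sigma_sets UNIV (range atMost)"
      using that by (auto simp: Int_stable_def borel_eq_atMost)
    then show ?thesis
    proof (induction rule: sigma_sets_induct_disjoint)
      case (compl A)
      then have A: "A \<in> sets borel" by (simp add: borel_eq_atMost)
      have "P (\<lambda>t. 1 + (-1) * indicator A t)"
        by (intro add scale one compl bounded_borel_scale bounded_borel_indicator A bounded_borel_const)
      moreover have "(\<lambda>t. 1 + (-1) * indicator A t) = (indicator (UNIV - A) :: real \<Rightarrow> complex)"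
        by (auto simp: indicator_def)
      ultimately show ?case by simp
    next
      case (union A)
      then have A: "A i \<in> sets borel" for i by (auto simp: borel_eq_atMost)
      have fin: "P (indicator (\<Union>i<n. A i))" for n
      proof (induction n)
        case (Suc n)
        have "P (\<lambda>t. indicator (\<Union>i<n. A i) t + indicator (A n) t)"
          by (intro add Suc union bounded_borel_indicator A sets.finite_UN) (auto intro: A)
        moreover have "(\<lambda>t. indicator (\<Union>i<n. A i) t + indicator (A n) t)
          = (indicator (\<Union>i<Suc n. A i) :: real \<Rightarrow> complex)"
        proof
          fix t
          have "(\<Union>i<n. A i) \<inter> A n = {}"
            using disjoint_family_onD[OF union(1), of _ n] by force
          then show "indicator (\<Union>i<n. A i) t + indicator (A n) t = (indicator (\<Union>i<Suc n. A i) t :: complex)"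
            by (auto simp: indicator_def lessThan_Suc)
        qed
        ultimately show ?case by simp
      next
        case 0
        have "(indicator {} :: real \<Rightarrow> complex) = (\<lambda>t. 0)" by (rule ext) simp
        then show ?case using zero by simp
      qed
      show ?case
      proof (rule lim[where F = "\<lambda>n. indicator (\<Union>i<n. A i)" and M = 1])
        show "bounded_borel (indicator (\<Union>i<n. A i))" for n
          by (intro bounded_borel_indicator sets.finite_UN) (auto intro: A)
        show "bounded_borel (indicator (\<Union>i. A i))"
          by (intro bounded_borel_indicator sets.countable_UN'') (auto intro: A)
        show "(\<lambda>n. indicator (\<Union>i<n. A i) t) \<longlonglongrightarrow> (indicator (\<Union>i. A i) t :: complex)" for t
          by (rule LIMSEQ_indicator_UN)
        show "cmod (indicator (\<Union>i<n. A i) t) \<le> 1" for n t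
          by (simp add: indicator_def)
      qed (rule fin)
    next
      case (basic A)
      then show ?case using halfline by auto
    next
      case empty
      have "(indicator {} :: real \<Rightarrow> complex) = (\<lambda>t. 0)" by (rule ext) simp
      then show ?case using zero by simp
    qed
  qed
  have sum: "bounded_borel (\<lambda>t. \<Sum>i\<in>I. F i t) \<and> P (\<lambda>t. \<Sum>i\<in>I. F i t)"
    if "finite I" "\<And>i. i \<in> I \<Longrightarrow> bounded_borel (F i) \<and> P (F i)" for I :: "complex set" and F
    using that by (induction I rule: finite_induct) (auto intro: zero add bounded_borel_add)
  obtain M where M: "0 < M" "\<And>t. cmod (\<phi> t) \<le> M" using \<phi> bounded_borel_bound by metis
  obtain S where S: "\<And>i. simple_function borel (S i)" "\<And>t. (\<lambda>i. S i t) \<longlonglongrightarrow> \<phi> t"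
      "\<And>i t. cmod (S i t) \<le> 2 * cmod (\<phi> t)"
    using borel_measurable_implies_sequence_metric[OF bounded_borel_measurable[OF \<phi>], of 0] by auto
  have simple: "bounded_borel (S i) \<and> P (S i)" for i
  proof -
    have fin: "finite (range (S i))" using simple_functionD(1)[OF S(1)] by simp
    have sets_S: "S i -` {y} \<in> sets borel" for y
      using simple_functionD(2)[OF S(1), of i "{y}"] by simp
    have "S i = (\<lambda>t. \<Sum>y\<in>range (S i). y * indicator (S i -` {y}) t)"
    proof
      fix t
      have "(\<Sum>y\<in>range (S i). y * indicator (S i -` {y}) t) = (\<Sum>y\<in>range (S i). if y = S i t then y else 0)"
        by (intro sum.cong) (auto simp: indicator_def)
      then show "S i t = (\<Sum>y\<in>range (S i). y * indicator (S i -` {y}) t)"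
        using fin by simp
    qed
    moreover have "bounded_borel (\<lambda>t. \<Sum>y\<in>range (S i). y * indicator (S i -` {y}) t) \<and>
        P (\<lambda>t. \<Sum>y\<in>range (S i). y * indicator (S i -` {y}) t)"
      by (rule sum[OF fin]) (auto intro!: scale sets bounded_borel_scale bounded_borel_indicator sets_S)
    ultimately show ?thesis by simp
  qed
  show ?thesis
  proof (rule lim[where F = S and M = "2 * M"])
    show "cmod (S n t) \<le> 2 * M" for n t
      using S(3)[of n t] M(2)[of t] by linarith
  qed (use simple S \<phi> in auto)
qed

section \<open>Bounded operators and their weak limits\<close>

lemma bounded_clinearD:
  assumes "bounded_clinear T"
  shows "T (x + y) = T x + T y" "T (c *\<^sub>C x) = c *\<^sub>C T x" "T (x - y) = T x - T y" "T 0 = 0" "T (- x) = - T x"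
  using assms linear_add[of T] linear_diff[of T] linear_0[of T] linear_neg[of T]
  unfolding bounded_clinear_def by (auto dest: bounded_linear.linear)

lemma bounded_clinearI:
  assumes "\<And>x y. T (x + y) = T x + T y" "\<And>c x. T (c *\<^sub>C x) = c *\<^sub>C T x" "\<And>x. norm (T x) \<le> C * norm x"
  shows "bounded_clinear T"
  unfolding bounded_clinear_def
  by (auto intro!: bounded_linear_intro[where K = C] simp: assms scaleR_eq_scaleC mult.commute)

lemma bounded_clinear_bound:
  assumes "bounded_clinear T"
  obtains K where "0 < K" "\<And>x. norm (T x) \<le> K * norm x"
  using assms bounded_linear.pos_bounded[of T] unfolding bounded_clinear_def by (metis mult.commute)

lemma bounded_clinear_tendsto:
  "bounded_clinear T \<Longrightarrow> (f \<longlongrightarrow> l) F \<Longrightarrow> ((\<lambda>x. T (f x)) \<longlongrightarrow> T l) F"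
  unfolding bounded_clinear_def using bounded_linear.tendsto by blast

lemma bounded_clinear_compose: "bounded_clinear S \<Longrightarrow> bounded_clinear T \<Longrightarrow> bounded_clinear (\<lambda>x. S (T x))"
  unfolding bounded_clinear_def using bounded_linear_compose by auto

lemma polarization_op:
  assumes "bounded_clinear T"
  shows "(\<Sum>k<4. \<i> ^ k * cinner (f + \<i> ^ k *\<^sub>C g) (T (f + \<i> ^ k *\<^sub>C g))) / 4 = cinner g (T f)"
  by (rule polarization) (simp_all add: cinner_add_left cinner_add_right bounded_clinearD[OF assms]
      cinner_scaleC_left cinner_scaleC_right)

text \<open>By polarization the modulus of \<open>cinner g (T f)\<close> is at most \<open>M (\<parallel>f\<parallel>\<^sup>2 + \<parallel>g\<parallel>\<^sup>2)\<close>. The factor \<open>2\<close> comes from taking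
  for \<open>g\<close> the multiple of \<open>T f\<close> that has the length of \<open>f\<close>.\<close>

lemma norm_le_numerical_radius:
  assumes T: "bounded_clinear T" and bound: "\<And>f. cmod (cinner f (T f)) \<le> M * (norm f)\<^sup>2"
  shows "norm (T f) \<le> 2 * M * norm f"
proof (cases "T f = 0")
  case True
  have "0 \<le> M * norm f" if "f \<noteq> 0"
  proof -
    have "0 \<le> M * (norm f)\<^sup>2" using bound[of f] by (smt (verit) norm_ge_zero)
    then show ?thesis using that by (simp add: zero_le_mult_iff)
  qed
  then show ?thesis using True by (cases "f = 0") auto
next
  case False
  have half: "cmod (cinner g (T f)) \<le> M * ((norm f)\<^sup>2 + (norm g)\<^sup>2)" for g
  proof -
    have "cmod (4 * cinner g (T f)) = cmod (\<Sum>k<4. \<i> ^ k * cinner (f + \<i> ^ k *\<^sub>C g) (T (f + \<i> ^ k *\<^sub>C g)))"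
      by (subst polarization_op[OF T, symmetric]) simp
    also have "\<dots> \<le> (\<Sum>k<4. M * (norm (f + \<i> ^ k *\<^sub>C g))\<^sup>2)"
      by (intro sum_norm_le) (simp add: norm_mult norm_power bound)
    also have "\<dots> = 4 * (M * ((norm f)\<^sup>2 + (norm g)\<^sup>2))"
      by (simp add: eval_nat_numeral norm_add_sq[unfolded power2_eq_square] norm_scaleC cinner_scaleC_right algebra_simps)
    finally show ?thesis by (simp add: norm_mult)
  qed
  define a where "a = norm f / norm (T f)"
  have "cmod (cinner (complex_of_real a *\<^sub>C T f) (T f)) = norm f * norm (T f)"
    using False by (simp add: cinner_scaleC_left cinner_self a_def norm_mult norm_divide norm_power power2_eq_square)
  moreover have "norm (complex_of_real a *\<^sub>C T f) = norm f"
    using False by (simp add: norm_scaleC a_def norm_divide)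
  ultimately have *: "norm f * norm (T f) \<le> norm f * (2 * M * norm f)"
    using half[of "complex_of_real a *\<^sub>C T f"] by (simp add: power2_eq_square algebra_simps)
  have "f \<noteq> 0" using False bounded_clinearD(4)[OF T] by auto
  then show ?thesis using * by simp
qed

text \<open>The limit of the sesquilinear forms is a bounded sesquilinear form, which the Riesz theorem represents.\<close>

lemma bounded_clinear_weak_limit:
  fixes T :: "nat \<Rightarrow> 'a::chilbert_space \<Rightarrow> 'a"
  assumes T: "\<And>n. bounded_clinear (T n)"
    and bound: "\<And>n f. norm (T n f) \<le> C * norm f"
    and conv: "\<And>g f. convergent (\<lambda>n. cinner g (T n f))"
  obtains S where "bounded_clinear S" "\<And>g f. (\<lambda>n. cinner g (T n f)) \<longlonglongrightarrow> cinner g (S f)"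
proof -
  have "\<exists>h. \<forall>g. cinner g h = lim (\<lambda>n. cinner g (T n f))" for f
  proof (rule riesz_representation[of "\<lambda>g. lim (\<lambda>n. cinner g (T n f))" "C * norm f"])
    show "lim (\<lambda>n. cinner (x + y) (T n f)) = lim (\<lambda>n. cinner x (T n f)) + lim (\<lambda>n. cinner y (T n f))" for x y
      using conv[unfolded convergent_LIMSEQ_iff]
      by (intro limI) (auto simp: cinner_add_left intro: tendsto_add)
    show "lim (\<lambda>n. cinner (c *\<^sub>C x) (T n f)) = cnj c * lim (\<lambda>n. cinner x (T n f))" for c x
      using conv[unfolded convergent_LIMSEQ_iff]
      by (intro limI) (auto simp: cinner_scaleC_left intro: tendsto_mult_left)
    show "cmod (lim (\<lambda>n. cinner x (T n f))) \<le> C * norm f * norm x" for x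
    proof (rule tendsto_upperbound)
      show "(\<lambda>n. cmod (cinner x (T n f))) \<longlonglongrightarrow> cmod (lim (\<lambda>n. cinner x (T n f)))"
        by (intro tendsto_norm conv[unfolded convergent_LIMSEQ_iff])
      have "cmod (cinner x (T n f)) \<le> C * norm f * norm x" for n
        using cauchy_schwarz[of x "T n f"] mult_left_mono[OF bound norm_ge_zero[of x]] order_trans
        by (fastforce simp: mult.commute)
      then show "\<forall>\<^sub>F n in sequentially. cmod (cinner x (T n f)) \<le> C * norm f * norm x" by simp
    qed simp
  qed blast
  then obtain S where S: "\<And>f g. cinner g (S f) = lim (\<lambda>n. cinner g (T n f))" by metis
  have lim: "(\<lambda>n. cinner g (T n f)) \<longlonglongrightarrow> cinner g (S f)" for g f
    using conv by (simp add: S convergent_LIMSEQ_iff)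
  have "bounded_clinear S"
  proof (rule bounded_clinearI[where C = C])
    show "S (x + y) = S x + S y" for x y
    proof (rule cinner_eqI)
      fix g
      have "(\<lambda>n. cinner g (T n x) + cinner g (T n y)) \<longlonglongrightarrow> cinner g (S x) + cinner g (S y)"
        by (intro tendsto_add lim)
      then show "cinner g (S (x + y)) = cinner g (S x + S y)"
        using LIMSEQ_unique[OF lim[of g "x + y"]] by (simp add: bounded_clinearD[OF T] cinner_add_right)
    qed
    show "S (c *\<^sub>C x) = c *\<^sub>C S x" for c x
    proof (rule cinner_eqI)
      fix g
      have "(\<lambda>n. c * cinner g (T n x)) \<longlonglongrightarrow> c * cinner g (S x)"
        by (intro tendsto_mult_left lim)
      then show "cinner g (S (c *\<^sub>C x)) = cinner g (c *\<^sub>C S x)"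
        using LIMSEQ_unique[OF lim[of g "c *\<^sub>C x"]] by (simp add: bounded_clinearD[OF T] cinner_scaleC_right)
    qed
    show "norm (S f) \<le> C * norm f" for f
    proof (cases "S f = 0")
      case True
      then show ?thesis using order_trans[OF norm_ge_zero bound[of 0 f]] by simp
    next
      case False
      have "cmod (cinner (S f) (S f)) \<le> norm (S f) * (C * norm f)"
      proof (rule tendsto_upperbound[OF tendsto_norm[OF lim]])
        have "cmod (cinner (S f) (T n f)) \<le> norm (S f) * (C * norm f)" for n
          using cauchy_schwarz[of "S f" "T n f"] mult_left_mono[OF bound[of n f] norm_ge_zero[of "S f"]] by linarith
        then show "\<forall>\<^sub>F n in sequentially. cmod (cinner (S f) (T n f)) \<le> norm (S f) * (C * norm f)" by simp
      qed simp
      then show ?thesis using False by (simp add: cinner_self norm_mult power2_eq_square)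
    qed
  qed
  with lim show ?thesis using that by blast
qed

section \<open>The bounded functional calculus\<close>

text \<open>For a bounded Borel function \<open>\<phi>\<close> this is the operator \<open>\<integral> \<phi>(\<lambda>) dE(\<lambda>)\<close>.\<close>

definition bcalc :: "(real \<Rightarrow> 'a::chilbert_space \<Rightarrow> 'a) \<Rightarrow> (real \<Rightarrow> complex) \<Rightarrow> 'a \<Rightarrow> 'a" where
  "bcalc E \<phi> f = (THE h. \<forall>g. cinner g h = spectral_form E UNIV \<phi> g f)"

lemma spectral_form_UNIV:
  "spectral_form E UNIV \<phi> g f =
     (\<Sum>k<4. \<i> ^ k * (LINT t|spectral_measure E (f + \<i> ^ k *\<^sub>C g). \<phi> t)) / 4"
  by (simp add: spectral_form_def set_lebesgue_integral_def)

lemma sets_spectral_measure [simp, measurable_cong]: "sets (spectral_measure E f) = sets borel"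
  by (simp add: spectral_measure_def)

lemma space_spectral_measure [simp]: "space (spectral_measure E f) = UNIV"
  by (simp add: spectral_measure_def)

locale spectral_calculus =
  fixes E :: "real \<Rightarrow> 'a::chilbert_space \<Rightarrow> 'a"
  assumes spectral_family: "spectral_family E"
begin

abbreviation \<mu> :: "'a \<Rightarrow> real measure" where "\<mu> \<equiv> spectral_measure E"

lemma E_clinear: "bounded_clinear (E t)"
  and E_sym: "cinner x (E t y) = cinner (E t x) y"
  and E_E: "E s (E t x) = E (min s t) x"
  and E_right: "((\<lambda>s. E s x) \<longlongrightarrow> E t x) (at_right t)"
  and E_bot: "((\<lambda>s. E s x) \<longlongrightarrow> 0) at_bot"
  and E_top: "((\<lambda>s. E s x) \<longlongrightarrow> x) at_top"
  using spectral_family unfolding spectral_family_def by blast+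

lemma cinner_E_self: "cinner f (E t f) = of_real ((norm (E t f))\<^sup>2)"
  using E_sym[of f t "E t f"] by (simp add: E_E cinner_self)

lemma norm_E_mono: "s \<le> t \<Longrightarrow> norm (E s f) \<le> norm (E t f)"
proof -
  assume "s \<le> t"
  have "norm (E s x) \<le> norm x" for x
  proof (cases "E s x = 0")
    case False
    have "cmod (cinner x (E s x)) \<le> norm x * norm (E s x)" by (rule cauchy_schwarz)
    then show ?thesis using False by (simp add: cinner_E_self norm_mult power2_eq_square)
  qed simp
  from this[of "E t f"] \<open>s \<le> t\<close> show ?thesis by (simp add: E_E min_def)
qed

lemma
  shows finite_measure_\<mu>: "finite_measure (\<mu> f)"
    and measure_\<mu>_halfline: "measure (\<mu> f) {..t} = (norm (E t f))\<^sup>2"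
    and measure_\<mu>_UNIV: "measure (\<mu> f) UNIV = (norm f)\<^sup>2"
proof -
  let ?F = "\<lambda>t. (norm (E t f))\<^sup>2"
  have \<mu>: "\<mu> f = interval_measure ?F"
    by (simp add: spectral_measure_def cinner_E_self)
  have mono: "s \<le> t \<Longrightarrow> ?F s \<le> ?F t" for s t
    by (simp add: norm_E_mono power_mono)
  have right: "continuous (at_right t) ?F" for t
    unfolding continuous_within by (intro tendsto_intros E_right)
  have bot: "(?F \<longlongrightarrow> 0) at_bot"
    using tendsto_power[OF tendsto_norm[OF E_bot], where n = 2] by simp
  have top: "(?F \<longlongrightarrow> (norm f)\<^sup>2) at_top"
    by (intro tendsto_intros E_top)
  note F = mono right bot
  show "measure (\<mu> f) {..t} = (norm (E t f))\<^sup>2"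
    unfolding \<mu> by (rule measure_interval_measure_Iic[OF F])
  have "emeasure (\<mu> f) UNIV = (norm f)\<^sup>2"
    unfolding \<mu> by (rule interval_measure_UNIV[OF F top]) (assumption | rule zero_le_power2)+
  then show "finite_measure (\<mu> f)" "measure (\<mu> f) UNIV = (norm f)\<^sup>2"
    by (auto intro!: finite_measureI simp: measure_def)
qed

lemma integrable_bounded_borel: "bounded_borel \<phi> \<Longrightarrow> integrable (\<mu> f) \<phi>"
proof -
  assume \<phi>: "bounded_borel \<phi>"
  then obtain M where "\<And>t. cmod (\<phi> t) \<le> M" using bounded_borel_bound by metis
  moreover have "\<phi> \<in> borel_measurable (\<mu> f)" using \<phi> by measurable
  ultimately show ?thesis
    by (intro finite_measure.integrable_const_bound[OF finite_measure_\<mu>, where B = M]) auto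
qed

lemma integral_bounded_tendsto:
  assumes "\<And>n. bounded_borel (F n)" "bounded_borel \<phi>" "\<And>n t. cmod (F n t) \<le> M"
    and "\<And>t. (\<lambda>n. F n t) \<longlonglongrightarrow> \<phi> t"
  shows "(\<lambda>n. LINT t|\<mu> f. F n t) \<longlonglongrightarrow> (LINT t|\<mu> f. \<phi> t)"
proof (rule integral_dominated_convergence[where w = "\<lambda>_. M"])
  show "integrable (\<mu> f) (\<lambda>_. M)"
    using finite_measure.integrable_const[OF finite_measure_\<mu>] .
  show "F n \<in> borel_measurable (\<mu> f)" for n using assms(1)[of n] by measurable
  show "\<phi> \<in> borel_measurable (\<mu> f)" using assms(2) by measurable
qed (use assms in auto)

lemma complex_integral_indicator:
  assumes "A \<in> sets borel"
  shows "integral\<^sup>L (\<mu> f) (indicator A) = complex_of_real (measure (\<mu> f) A)"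
proof -
  have "integral\<^sup>L (\<mu> f) (indicator A) = (LINT t|\<mu> f. complex_of_real (indicator A t))"
    by (intro Bochner_Integration.integral_cong) (auto simp: indicator_def)
  then show ?thesis using assms by (simp add: integral_complex_of_real)
qed

lemma cinner_E_eq_integral: "cinner f (E t f) = (LINT s|\<mu> f. indicator {..t} s)"
  by (simp add: cinner_E_self measure_\<mu>_halfline complex_integral_indicator)

text \<open>The operators are obtained by the induction principle, starting from \<open>E t\<close> for the half-line
  \<open>{..t}\<close>. Dominated convergence of the scalar integrals gives weak convergence of the operators; the
  norms are uniformly bounded because the numerical radii are.\<close>

lemma bcalc_exists:
  assumes "bounded_borel \<phi>"
  shows "\<exists>T. bounded_clinear T \<and> (\<forall>f. cinner f (T f) = (LINT t|\<mu> f. \<phi> t))"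
  using assms
proof (induction rule: bounded_borel_induct)
  case (halfline t)
  show ?case using E_clinear cinner_E_eq_integral by blast
next
  case (add \<phi> \<psi>)
  then obtain T S where T: "bounded_clinear T" "\<And>f. cinner f (T f) = (LINT t|\<mu> f. \<phi> t)"
    and S: "bounded_clinear S" "\<And>f. cinner f (S f) = (LINT t|\<mu> f. \<psi> t)" by blast
  have "bounded_clinear (\<lambda>x. T x + S x)"
    using T(1) S(1) bounded_linear_add unfolding bounded_clinear_def by (auto simp: scaleC_add_right)
  moreover have "cinner f (T f + S f) = (LINT t|\<mu> f. \<phi> t + \<psi> t)" for f
    using add by (simp add: cinner_add_right T S integrable_bounded_borel)
  ultimately show ?case by blast
next
  case (scale c \<phi>)
  then obtain T where T: "bounded_clinear T" "\<And>f. cinner f (T f) = (LINT t|\<mu> f. \<phi> t)" by blast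
  obtain K where K: "\<And>x. norm (T x) \<le> K * norm x" using bounded_clinear_bound[OF T(1)] by blast
  have "bounded_clinear (\<lambda>x. c *\<^sub>C T x)"
    by (rule bounded_clinearI[where C = "cmod c * K"])
      (use mult_left_mono[OF K norm_ge_zero[of c]] in \<open>auto simp: bounded_clinearD[OF T(1)]
        scaleC_add_right scaleC_scaleC norm_scaleC mult.assoc mult.commute[of c]\<close>)
  moreover have "cinner f (c *\<^sub>C T f) = (LINT t|\<mu> f. c * \<phi> t)" for f
    using scale by (simp add: cinner_scaleC_right T integrable_bounded_borel)
  ultimately show ?case by blast
next
  case (lim F \<phi> M)
  then obtain T where T: "\<And>n. bounded_clinear (T n)" "\<And>n f. cinner f (T n f) = (LINT t|\<mu> f. F n t)" by metis
  have "cmod (cinner f (T n f)) \<le> M * (norm f)\<^sup>2" for n f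
  proof -
    have "cmod (LINT t|\<mu> f. F n t) \<le> (LINT t|\<mu> f. M)"
      by (rule Bochner_Integration.integral_norm_bound_integral)
        (use lim in \<open>auto intro: integrable_bounded_borel finite_measure.integrable_const[OF finite_measure_\<mu>]\<close>)
    then show ?thesis by (simp add: T(2) measure_\<mu>_UNIV mult.commute)
  qed
  then have bound: "norm (T n f) \<le> 2 * M * norm f" for n f
    by (rule norm_le_numerical_radius[OF T(1)])
  have conv: "(\<lambda>n. cinner g (T n f)) \<longlonglongrightarrow> spectral_form E UNIV \<phi> g f" for g f
  proof -
    have "(\<lambda>n. (\<Sum>k<4. \<i> ^ k * (LINT t|\<mu> (f + \<i> ^ k *\<^sub>C g). F n t)) / 4) \<longlonglongrightarrow> spectral_form E UNIV \<phi> g f"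
      unfolding spectral_form_UNIV
      by (intro tendsto_intros integral_bounded_tendsto[where M = M] lim) simp
    then show ?thesis using polarization_op[OF T(1)] by (simp add: T(2))
  qed
  obtain S where S: "bounded_clinear S" "\<And>g f. (\<lambda>n. cinner g (T n f)) \<longlonglongrightarrow> cinner g (S f)"
    using bounded_clinear_weak_limit[OF T(1) bound convergentI[OF conv]] by blast
  have "(\<lambda>n. cinner f (T n f)) \<longlonglongrightarrow> (LINT t|\<mu> f. \<phi> t)" for f
    unfolding T(2) by (rule integral_bounded_tendsto[where M = M]) (use lim in auto)
  then have "cinner f (S f) = (LINT t|\<mu> f. \<phi> t)" for f
    using LIMSEQ_unique[OF S(2)] by blast
  then show ?case using S(1) by blast
qed

lemma bcalc_eqI:
  assumes "bounded_clinear T" "\<And>f. cinner f (T f) = (LINT t|\<mu> f. \<phi> t)"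
  shows "bcalc E \<phi> = T"
proof
  fix f
  have "cinner g (T f) = spectral_form E UNIV \<phi> g f" for g
    using polarization_op[OF assms(1), of f g] by (simp add: assms(2) spectral_form_UNIV)
  then show "bcalc E \<phi> f = T f"
    unfolding bcalc_def by (intro the_equality) (auto intro: cinner_eqI)
qed

lemma
  assumes "bounded_borel \<phi>"
  shows bcalc_clinear: "bounded_clinear (bcalc E \<phi>)"
    and cinner_bcalc_self: "cinner f (bcalc E \<phi> f) = (LINT t|\<mu> f. \<phi> t)"
    and cinner_bcalc: "cinner g (bcalc E \<phi> f) = spectral_form E UNIV \<phi> g f"
proof -
  obtain T where T: "bounded_clinear T" "\<And>f. cinner f (T f) = (LINT t|\<mu> f. \<phi> t)"
    using bcalc_exists[OF assms] by blast
  have eq: "bcalc E \<phi> = T" by (rule bcalc_eqI[OF T])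
  show 1: "bounded_clinear (bcalc E \<phi>)" using T(1) eq by simp
  show 2: "cinner f (bcalc E \<phi> f) = (LINT t|\<mu> f. \<phi> t)" for f using T(2) eq by simp
  show "cinner g (bcalc E \<phi> f) = spectral_form E UNIV \<phi> g f"
    using polarization_op[OF 1, of f g] by (simp add: 2 spectral_form_UNIV)
qed

lemma bcalc_halfline: "bcalc E (indicator {..t}) = E t"
  by (rule bcalc_eqI[OF E_clinear cinner_E_eq_integral])

lemma bcalc_one: "bcalc E (\<lambda>t. 1) = (\<lambda>x. x)"
  by (rule bcalc_eqI) (auto simp: bounded_clinear_def bounded_linear_ident cinner_self measure_\<mu>_UNIV scaleR_conv_of_real)

lemma bcalc_add:
  assumes "bounded_borel \<phi>" "bounded_borel \<psi>"
  shows "bcalc E (\<lambda>t. \<phi> t + \<psi> t) f = bcalc E \<phi> f + bcalc E \<psi> f"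
proof -
  have "bounded_clinear (\<lambda>x. bcalc E \<phi> x + bcalc E \<psi> x)"
    using bcalc_clinear[OF assms(1)] bcalc_clinear[OF assms(2)] bounded_linear_add
    unfolding bounded_clinear_def by (auto simp: scaleC_add_right)
  then have "bcalc E (\<lambda>t. \<phi> t + \<psi> t) = (\<lambda>x. bcalc E \<phi> x + bcalc E \<psi> x)"
    by (rule bcalc_eqI) (use assms in \<open>simp add: cinner_add_right cinner_bcalc_self integrable_bounded_borel\<close>)
  then show ?thesis by simp
qed

lemma bcalc_scale:
  assumes "bounded_borel \<phi>"
  shows "bcalc E (\<lambda>t. c * \<phi> t) f = c *\<^sub>C bcalc E \<phi> f"
proof (rule cinner_eqI)
  fix g
  show "cinner g (bcalc E (\<lambda>t. c * \<phi> t) f) = cinner g (c *\<^sub>C bcalc E \<phi> f)"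
    using assms by (simp add: cinner_bcalc bounded_borel_scale cinner_scaleC_right spectral_form_UNIV
        integrable_bounded_borel sum_distrib_left mult.left_commute)
qed

lemma bcalc_diff:
  assumes "bounded_borel \<phi>" "bounded_borel \<psi>"
  shows "bcalc E (\<lambda>t. \<phi> t - \<psi> t) f = bcalc E \<phi> f - bcalc E \<psi> f"
  using bcalc_add[OF assms(1) bounded_borel_scale[OF assms(2), of "-1"], of f] bcalc_scale[OF assms(2), of "-1" f]
  by (simp add: scaleC_minus_one)

lemma bcalc_const: "bcalc E (\<lambda>t. c) f = c *\<^sub>C f"
  using bcalc_scale[of "\<lambda>t. 1" c f] by (simp add: bcalc_one)

text \<open>Both sides are sesquilinear in \<open>g\<close> and \<open>f\<close> and agree on the diagonal, where they are integrals
  against the same positive measure.\<close>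

lemma bcalc_adjoint:
  assumes "bounded_borel \<phi>"
  shows "cinner g (bcalc E \<phi> f) = cinner (bcalc E (\<lambda>t. cnj (\<phi> t)) g) f"
proof -
  note lin = bounded_clinearD[OF bcalc_clinear[OF assms]]
    bounded_clinearD[OF bcalc_clinear[OF bounded_borel_cnj[OF assms]]]
  have diag: "cinner (bcalc E (\<lambda>t. cnj (\<phi> t)) x) x = cinner x (bcalc E \<phi> x)" for x
    by (subst cinner_commute) (simp add: cinner_bcalc_self assms bounded_borel_cnj)
  have "(\<Sum>k<4. \<i> ^ k * cinner (bcalc E (\<lambda>t. cnj (\<phi> t)) (f + \<i> ^ k *\<^sub>C g)) (f + \<i> ^ k *\<^sub>C g)) / 4
      = cinner (bcalc E (\<lambda>t. cnj (\<phi> t)) g) f"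
    by (rule polarization) (simp_all add: lin cinner_add_left cinner_add_right cinner_scaleC_left cinner_scaleC_right)
  then show ?thesis
    using polarization_op[OF bcalc_clinear[OF assms], of f g] by (simp add: diag)
qed

lemma bcalc_weak_tendsto:
  assumes "\<And>n. bounded_borel (F n)" "bounded_borel \<phi>" "\<And>n t. cmod (F n t) \<le> M"
    and "\<And>t. (\<lambda>n. F n t) \<longlonglongrightarrow> \<phi> t"
  shows "(\<lambda>n. cinner g (bcalc E (F n) f)) \<longlonglongrightarrow> cinner g (bcalc E \<phi> f)"
  unfolding cinner_bcalc[OF assms(1)] cinner_bcalc[OF assms(2)] spectral_form_UNIV
  by (intro tendsto_intros integral_bounded_tendsto[where M = M] assms) simp

text \<open>Multiplicativity is inherited from \<open>E s (E t x) = E (min s t) x\<close>, first in the left factor and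
  then, after moving the left operator to the other side of the inner product, in the right factor.\<close>

lemma bcalc_E:
  assumes "bounded_borel \<phi>"
  shows "bcalc E \<phi> (E t f) = bcalc E (\<lambda>s. \<phi> s * indicator {..t} s) f"
  using assms
proof (induction rule: bounded_borel_induct)
  case (halfline s)
  have "(\<lambda>r. indicator {..s} r * indicator {..t} r) = (indicator {..min s t} :: real \<Rightarrow> complex)"
    by (auto simp: indicator_def)
  then show ?case by (simp add: bcalc_halfline E_E)
next
  case (add \<phi> \<psi>)
  have i: "bounded_borel (indicator {..t})" by (rule bounded_borel_indicator) simp
  show ?case
    using add bcalc_add[OF add(1,2)] bcalc_add[OF bounded_borel_mult[OF add(1) i] bounded_borel_mult[OF add(2) i]]
    by (simp add: algebra_simps)
next
  case (scale c \<phi>)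
  have i: "bounded_borel (indicator {..t})" by (rule bounded_borel_indicator) simp
  show ?case
    using scale bcalc_scale[OF scale(1)] bcalc_scale[OF bounded_borel_mult[OF scale(1) i]]
    by (simp add: algebra_simps)
next
  case (lim F \<phi> M)
  have i: "bounded_borel (indicator {..t})" by (rule bounded_borel_indicator) simp
  show ?case
  proof (rule cinner_eqI)
    fix g
    have "(\<lambda>n. cinner g (bcalc E (F n) (E t f))) \<longlonglongrightarrow> cinner g (bcalc E \<phi> (E t f))"
      by (rule bcalc_weak_tendsto[where M = M]) (use lim in auto)
    moreover have "(\<lambda>n. cinner g (bcalc E (\<lambda>s. F n s * indicator {..t} s) f))
        \<longlonglongrightarrow> cinner g (bcalc E (\<lambda>s. \<phi> s * indicator {..t} s) f)"
    proof (rule bcalc_weak_tendsto[where M = M])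
      show "cmod (F n s * indicator {..t} s) \<le> M" for n s
        using lim(3)[of n s] order_trans[OF norm_ge_zero lim(3)[of n s]] by (auto simp: indicator_def)
    qed (use lim i in \<open>auto intro: bounded_borel_mult tendsto_mult_right\<close>)
    ultimately show "cinner g (bcalc E \<phi> (E t f)) = cinner g (bcalc E (\<lambda>s. \<phi> s * indicator {..t} s) f)"
      using LIMSEQ_unique by (simp add: lim)
  qed
qed

lemma bcalc_mult:
  assumes \<phi>: "bounded_borel \<phi>" and "bounded_borel \<psi>"
  shows "bcalc E \<phi> (bcalc E \<psi> f) = bcalc E (\<lambda>t. \<phi> t * \<psi> t) f"
  using assms(2)
proof (induction rule: bounded_borel_induct)
  case (halfline t)
  show ?case by (simp add: bcalc_halfline bcalc_E[OF \<phi>])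
next
  case (add \<psi> \<theta>)
  show ?case
    using add bcalc_add[OF add(1,2)] bcalc_add[OF bounded_borel_mult[OF \<phi> add(1)] bounded_borel_mult[OF \<phi> add(2)]]
    by (simp add: algebra_simps bounded_clinearD[OF bcalc_clinear[OF \<phi>]])
next
  case (scale c \<psi>)
  show ?case
    using scale bcalc_scale[OF scale(1)] bcalc_scale[OF bounded_borel_mult[OF \<phi> scale(1)]]
    by (simp add: mult.left_commute bounded_clinearD[OF bcalc_clinear[OF \<phi>]])
next
  case (lim F \<psi> M)
  obtain K where K: "0 < K" "\<And>t. cmod (\<phi> t) \<le> K" using bounded_borel_bound[OF \<phi>] by metis
  show ?case
  proof (rule cinner_eqI)
    fix g
    have "(\<lambda>n. cinner g (bcalc E \<phi> (bcalc E (F n) f))) \<longlonglongrightarrow> cinner g (bcalc E \<phi> (bcalc E \<psi> f))"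
      unfolding bcalc_adjoint[OF \<phi>, of g] by (rule bcalc_weak_tendsto[where M = M]) (use lim in auto)
    moreover have "(\<lambda>n. cinner g (bcalc E (\<lambda>s. \<phi> s * F n s) f)) \<longlonglongrightarrow> cinner g (bcalc E (\<lambda>s. \<phi> s * \<psi> s) f)"
    proof (rule bcalc_weak_tendsto[where M = "K * M"])
      show "cmod (\<phi> s * F n s) \<le> K * M" for n s
        using lim(3)[of n s] K by (simp add: norm_mult mult_mono')
    qed (use lim \<phi> in \<open>auto intro: bounded_borel_mult tendsto_mult_left\<close>)
    ultimately show "cinner g (bcalc E \<phi> (bcalc E \<psi> f)) = cinner g (bcalc E (\<lambda>s. \<phi> s * \<psi> s) f)"
      using LIMSEQ_unique by (simp add: lim)
  qed
qed

lemma norm_bcalc_sq: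
  assumes "bounded_borel \<phi>"
  shows "(norm (bcalc E \<phi> f))\<^sup>2 = (LINT t|\<mu> f. (cmod (\<phi> t))\<^sup>2)"
proof -
  have "complex_of_real ((norm (bcalc E \<phi> f))\<^sup>2) = cinner (bcalc E \<phi> f) (bcalc E \<phi> f)"
    by (simp add: cinner_self)
  also have "\<dots> = cinner f (bcalc E (\<lambda>t. cnj (\<phi> t) * \<phi> t) f)"
    using bcalc_adjoint[OF bounded_borel_cnj[OF assms], of f "bcalc E \<phi> f"]
      bcalc_mult[OF bounded_borel_cnj[OF assms] assms] by simp
  also have "\<dots> = (LINT t|\<mu> f. cnj (\<phi> t) * \<phi> t)"
    using assms by (simp add: cinner_bcalc_self bounded_borel_mult bounded_borel_cnj)
  also have "\<dots> = (LINT t|\<mu> f. complex_of_real ((cmod (\<phi> t))\<^sup>2))"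
    by (simp only: complex_norm_square mult.commute)
  also have "\<dots> = complex_of_real (LINT t|\<mu> f. (cmod (\<phi> t))\<^sup>2)"
    by (rule integral_complex_of_real)
  finally show ?thesis using of_real_eq_iff by blast
qed

lemma norm_bcalc_le:
  assumes "bounded_borel \<phi>" "\<And>t. cmod (\<phi> t) \<le> M"
  shows "norm (bcalc E \<phi> f) \<le> M * norm f"
proof -
  have M: "0 \<le> M" using assms(2)[of 0] norm_ge_zero order_trans by blast
  have m: "\<phi> \<in> borel_measurable (\<mu> f)" using assms(1) by measurable
  have "(LINT t|\<mu> f. (cmod (\<phi> t))\<^sup>2) \<le> (LINT t|\<mu> f. M\<^sup>2)"
  proof (rule integral_mono)
    show "integrable (\<mu> f) (\<lambda>t. (cmod (\<phi> t))\<^sup>2)"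
      using assms M m by (intro finite_measure.integrable_const_bound[OF finite_measure_\<mu>, where B = "M\<^sup>2"])
        (auto intro!: power_mono)
  qed (use assms M in \<open>auto intro: power_mono finite_measure.integrable_const[OF finite_measure_\<mu>]\<close>)
  then have "(norm (bcalc E \<phi> f))\<^sup>2 \<le> (M * norm f)\<^sup>2"
    by (simp add: norm_bcalc_sq[OF assms(1)] measure_\<mu>_UNIV power_mult_distrib mult.commute)
  then show ?thesis by (rule power2_le_imp_le) (simp add: M)
qed

text \<open>Dominated convergence holds for norms, not only weakly, since \<open>\<parallel>bcalc E \<phi> f\<parallel>\<^sup>2\<close> is itself the integral
  of \<open>\<bar>\<phi>\<bar>\<^sup>2\<close>.\<close>

lemma bcalc_tendsto:
  assumes F: "\<And>n. bounded_borel (F n)" "\<And>n t. cmod (F n t) \<le> M" and \<phi>: "bounded_borel \<phi>"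
    and lim: "\<And>t. (\<lambda>n. F n t) \<longlonglongrightarrow> \<phi> t"
  shows "(\<lambda>n. bcalc E (F n) f) \<longlonglongrightarrow> bcalc E \<phi> f"
proof -
  have \<phi>M: "cmod (\<phi> t) \<le> M" for t
    by (rule tendsto_upperbound[OF tendsto_norm[OF lim]]) (simp_all add: F)
  have d: "bounded_borel (\<lambda>t. F n t - \<phi> t)" for n by (intro bounded_borel_diff F \<phi>)
  have m: "(\<lambda>t. (cmod (F n t - \<phi> t))\<^sup>2) \<in> borel_measurable (\<mu> f)" for n
    using F(1)[of n] \<phi> by measurable
  have "(\<lambda>n. LINT t|\<mu> f. (cmod (F n t - \<phi> t))\<^sup>2) \<longlonglongrightarrow> (LINT t|\<mu> f. 0)"
  proof (rule integral_dominated_convergence[where w = "\<lambda>_. (2 * M)\<^sup>2"])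
    show "integrable (\<mu> f) (\<lambda>_. (2 * M)\<^sup>2)"
      using finite_measure.integrable_const[OF finite_measure_\<mu>] .
    have "cmod (F n t - \<phi> t) \<le> 2 * M" for n t
      using norm_triangle_ineq4[of "F n t" "\<phi> t"] F(2)[of n t] \<phi>M[of t] by linarith
    then have "(cmod (F n t - \<phi> t))\<^sup>2 \<le> (2 * M)\<^sup>2" for n t
      by (intro power_mono norm_ge_zero)
    then show "AE t in \<mu> f. norm ((cmod (F n t - \<phi> t))\<^sup>2) \<le> (2 * M)\<^sup>2" for n
      by (intro AE_I2) simp
    have "(\<lambda>n. (cmod (F n t - \<phi> t))\<^sup>2) \<longlonglongrightarrow> (cmod (\<phi> t - \<phi> t))\<^sup>2" for t
      by (intro tendsto_intros lim)
    then show "AE t in \<mu> f. (\<lambda>n. (cmod (F n t - \<phi> t))\<^sup>2) \<longlonglongrightarrow> 0" by simp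
  qed (use m in auto)
  then have "(\<lambda>n. sqrt ((norm (bcalc E (F n) f - bcalc E \<phi> f))\<^sup>2)) \<longlonglongrightarrow> sqrt 0"
    unfolding bcalc_diff[OF F(1) \<phi>, symmetric] norm_bcalc_sq[OF d] by (intro tendsto_real_sqrt) simp
  then have "(\<lambda>n. norm (bcalc E (F n) f - bcalc E \<phi> f)) \<longlonglongrightarrow> 0" by simp
  then show ?thesis by (rule LIM_zero_cancel[OF tendsto_norm_zero_cancel])
qed

end

section \<open>Unbounded spectral integrals\<close>

definition truncate :: "(real \<Rightarrow> complex) \<Rightarrow> nat \<Rightarrow> real \<Rightarrow> complex" where
  "truncate \<phi> n t = (if cmod (\<phi> t) \<le> real n then \<phi> t else 0)"

lemma truncate_eq_indicator: "truncate \<phi> n = (\<lambda>t. \<phi> t * indicator {t. cmod (\<phi> t) \<le> real n} t)"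
  by (auto simp: truncate_def indicator_def)

lemma cmod_truncate_le: "cmod (truncate \<phi> n t) \<le> cmod (\<phi> t)"
  by (simp add: truncate_def)

lemma truncate_eventually: "\<forall>\<^sub>F n in sequentially. truncate \<phi> n t = \<phi> t"
proof -
  obtain N where "cmod (\<phi> t) \<le> real N" using real_arch_simple by blast
  then show ?thesis
    by (intro eventually_sequentiallyI[of N]) (auto simp: truncate_def)
qed

lemma truncate_tendsto: "(\<lambda>n. truncate \<phi> n t) \<longlonglongrightarrow> \<phi> t"
  by (rule tendsto_eventually[OF truncate_eventually])

lemma truncate_measurable:
  assumes [measurable]: "\<phi> \<in> borel_measurable borel"
  shows "truncate \<phi> n \<in> borel_measurable borel"
  unfolding truncate_def[abs_def] by measurable

lemma bounded_borel_truncate: "\<phi> \<in> borel_measurable borel \<Longrightarrow> bounded_borel (truncate \<phi> n)"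
  by (rule bounded_borelI[where M = "real n"]) (auto simp: truncate_measurable truncate_def)

lemma spectral_integral_restrict:
  "spectral_integral E S \<phi> = spectral_integral E UNIV (\<lambda>t. indicator S t * \<phi> t)"
proof -
  have "indicator S t *\<^sub>R \<phi> t = indicator UNIV t *\<^sub>R (indicator S t * \<phi> t)" for t
    by (simp add: indicator_def)
  moreover have "indicator S t *\<^sub>R (cmod (\<phi> t))\<^sup>2 = indicator UNIV t *\<^sub>R (cmod (indicator S t * \<phi> t))\<^sup>2" for t
    by (simp add: indicator_def)
  ultimately show ?thesis
    unfolding spectral_integral_def spectral_dom_def spectral_form_def set_integrable_def
      set_lebesgue_integral_def by presburger
qed

context spectral_calculus
begin

lemma spectral_dom_UNIV_iff: "f \<in> spectral_dom E UNIV \<phi> \<longleftrightarrow> integrable (\<mu> f) (\<lambda>t. (cmod (\<phi> t))\<^sup>2)"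
  by (simp add: spectral_dom_def set_integrable_def)

text \<open>For \<open>N \<le> n\<close> the squared distance of the truncated vectors is at most the integral of
  \<open>\<bar>\<phi> - truncate \<phi> N\<bar>\<^sup>2\<close>, which tends to \<open>0\<close> by dominated convergence.\<close>

lemma convergent_if_spectral_dom:
  assumes \<phi>: "\<phi> \<in> borel_measurable borel" and f: "f \<in> spectral_dom E UNIV \<phi>"
  shows "convergent (\<lambda>n. bcalc E (truncate \<phi> n) f)"
proof -
  let ?a = "\<lambda>n. LINT t|\<mu> f. (cmod (\<phi> t - truncate \<phi> n t))\<^sup>2"
  note b = bounded_borel_truncate[OF \<phi>]
  have \<phi>': "\<phi> \<in> borel_measurable (\<mu> f)" using \<phi> by measurable
  have m: "truncate \<phi> n \<in> borel_measurable (\<mu> f)" for n using b[of n] by measurable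
  have i: "integrable (\<mu> f) (\<lambda>t. (cmod (\<phi> t))\<^sup>2)" using f by (simp add: spectral_dom_UNIV_iff)
  have i': "integrable (\<mu> f) (\<lambda>t. (cmod (\<phi> t - truncate \<phi> n t))\<^sup>2)" for n
    by (rule Bochner_Integration.integrable_bound[OF i]) (use \<phi>' m in \<open>auto simp: truncate_def\<close>)
  have "?a \<longlonglongrightarrow> (LINT t|\<mu> f. 0)"
  proof (rule integral_dominated_convergence[where w = "\<lambda>t. (cmod (\<phi> t))\<^sup>2"])
    have "(\<lambda>n. (cmod (\<phi> t - truncate \<phi> n t))\<^sup>2) \<longlonglongrightarrow> (cmod (\<phi> t - \<phi> t))\<^sup>2" for t
      by (intro tendsto_intros truncate_tendsto)
    then show "AE t in \<mu> f. (\<lambda>n. (cmod (\<phi> t - truncate \<phi> n t))\<^sup>2) \<longlonglongrightarrow> 0" by simp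
    show "AE t in \<mu> f. norm ((cmod (\<phi> t - truncate \<phi> n t))\<^sup>2) \<le> (cmod (\<phi> t))\<^sup>2" for n
      by (simp add: truncate_def)
    show "(\<lambda>t. (cmod (\<phi> t - truncate \<phi> n t))\<^sup>2) \<in> borel_measurable (\<mu> f)" for n
      using \<phi>' m by simp
  qed (use i in auto)
  then have a: "?a \<longlonglongrightarrow> 0" by simp
  have le: "(norm (bcalc E (truncate \<phi> n) f - bcalc E (truncate \<phi> N) f))\<^sup>2 \<le> ?a N" if "N \<le> n" for n N
  proof -
    have "(norm (bcalc E (truncate \<phi> n) f - bcalc E (truncate \<phi> N) f))\<^sup>2
        = (LINT t|\<mu> f. (cmod (truncate \<phi> n t - truncate \<phi> N t))\<^sup>2)"
      by (simp add: bcalc_diff[OF b b, symmetric] norm_bcalc_sq bounded_borel_diff b)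
    also have "\<dots> \<le> ?a N"
    proof (rule integral_mono[OF _ i'])
      show "integrable (\<mu> f) (\<lambda>t. (cmod (truncate \<phi> n t - truncate \<phi> N t))\<^sup>2)"
      proof (rule Bochner_Integration.integrable_bound[OF i])
        show "(\<lambda>t. (cmod (truncate \<phi> n t - truncate \<phi> N t))\<^sup>2) \<in> borel_measurable (\<mu> f)"
          using m[of n] m[of N] by simp
      qed (auto simp: truncate_def)
    qed (use that in \<open>auto simp: truncate_def\<close>)
    finally show ?thesis .
  qed
  have "Cauchy (\<lambda>n. bcalc E (truncate \<phi> n) f)"
  proof (rule CauchyI')
    fix e :: real assume e: "0 < e"
    have "\<forall>\<^sub>F n in sequentially. ?a n < e\<^sup>2"
      using order_tendstoD(2)[OF a, of "e\<^sup>2"] e by simp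
    then obtain N where N: "\<And>n. N \<le> n \<Longrightarrow> ?a n < e\<^sup>2" by (auto simp: eventually_sequentially)
    have "norm (bcalc E (truncate \<phi> m) f - bcalc E (truncate \<phi> n) f) < e" if "N \<le> m" "m < n" for m n
    proof (rule power_less_imp_less_base)
      show "(norm (bcalc E (truncate \<phi> m) f - bcalc E (truncate \<phi> n) f))\<^sup>2 < e\<^sup>2"
        using le[of m n] N[of m] that by (simp add: norm_minus_commute)
    qed (use e in simp)
    then show "\<exists>M. \<forall>m\<ge>M. \<forall>n>m. dist (bcalc E (truncate \<phi> m) f) (bcalc E (truncate \<phi> n) f) < e"
      by (auto simp: dist_norm)
  qed
  then show ?thesis by (rule Cauchy_convergent)
qed

text \<open>The integrals of \<open>\<bar>truncate \<phi> n\<bar>\<^sup>2\<close> are the squared norms of a convergent sequence, so monotone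
  convergence bounds the integral of \<open>\<bar>\<phi>\<bar>\<^sup>2\<close> by \<open>\<parallel>h\<parallel>\<^sup>2\<close>.\<close>

lemma spectral_dom_if_tendsto:
  assumes \<phi>: "\<phi> \<in> borel_measurable borel" and h: "(\<lambda>n. bcalc E (truncate \<phi> n) f) \<longlonglongrightarrow> h"
  shows "f \<in> spectral_dom E UNIV \<phi>"
  unfolding spectral_dom_UNIV_iff
proof (rule integrable_monotone_convergence)
  note b = bounded_borel_truncate[OF \<phi>]
  have \<phi>': "\<phi> \<in> borel_measurable (\<mu> f)" using \<phi> by measurable
  then show "(\<lambda>t. (cmod (\<phi> t))\<^sup>2) \<in> borel_measurable (\<mu> f)" by simp
  have m: "truncate \<phi> n \<in> borel_measurable (\<mu> f)" for n using b[of n] by measurable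
  show "integrable (\<mu> f) (\<lambda>t. (cmod (truncate \<phi> n t))\<^sup>2)" for n
  proof (rule finite_measure.integrable_const_bound[OF finite_measure_\<mu>])
    show "AE t in \<mu> f. norm ((cmod (truncate \<phi> n t))\<^sup>2) \<le> (real n)\<^sup>2"
      by (intro AE_I2) (auto simp: truncate_def intro!: power_mono)
  qed (use m in simp)
  show "AE t in \<mu> f. mono (\<lambda>n. (cmod (truncate \<phi> n t))\<^sup>2)"
    by (auto simp: truncate_def mono_def intro!: AE_I2)
  show "AE t in \<mu> f. (\<lambda>n. (cmod (truncate \<phi> n t))\<^sup>2) \<longlonglongrightarrow> (cmod (\<phi> t))\<^sup>2"
    by (intro AE_I2 tendsto_intros truncate_tendsto)
  have "(\<lambda>n. (norm (bcalc E (truncate \<phi> n) f))\<^sup>2) \<longlonglongrightarrow> (norm h)\<^sup>2"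
    by (intro tendsto_intros h)
  then show "(\<lambda>n. LINT t|\<mu> f. (cmod (truncate \<phi> n t))\<^sup>2) \<longlonglongrightarrow> (norm h)\<^sup>2"
    by (simp add: norm_bcalc_sq b)
qed

lemma spectral_dom_iff:
  "\<phi> \<in> borel_measurable borel \<Longrightarrow>
    f \<in> spectral_dom E UNIV \<phi> \<longleftrightarrow> convergent (\<lambda>n. bcalc E (truncate \<phi> n) f)"
  using convergent_if_spectral_dom[of \<phi> f] spectral_dom_if_tendsto[of \<phi> f] unfolding convergent_def by blast

text \<open>The spectral domain is a linear subspace, being described by convergence of linear expressions. Hence
  it contains the four vectors \<open>f + \<i>\<^sup>k g\<close> of the polarized integral, and \<open>1 + \<bar>\<phi>\<bar>\<^sup>2\<close> is an integrable
  majorant for each of their measures.\<close>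

lemma spectral_form_tendsto:
  assumes \<phi>: "\<phi> \<in> borel_measurable borel"
    and f: "f \<in> spectral_dom E UNIV \<phi>" and g: "g \<in> spectral_dom E UNIV \<phi>"
  shows "(\<lambda>n. cinner g (bcalc E (truncate \<phi> n) f)) \<longlonglongrightarrow> spectral_form E UNIV \<phi> g f"
proof -
  note b = bounded_borel_truncate[OF \<phi>]
  have "(\<lambda>n. LINT t|\<mu> x. truncate \<phi> n t) \<longlonglongrightarrow> (LINT t|\<mu> x. \<phi> t)" if "x \<in> spectral_dom E UNIV \<phi>" for x
  proof (rule integral_dominated_convergence[where w = "\<lambda>t. 1 + (cmod (\<phi> t))\<^sup>2"])
    show "integrable (\<mu> x) (\<lambda>t. 1 + (cmod (\<phi> t))\<^sup>2)"
      using that by (auto simp: spectral_dom_UNIV_iff intro: finite_measure.integrable_const[OF finite_measure_\<mu>])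
    show "\<phi> \<in> borel_measurable (\<mu> x)" using \<phi> by measurable
    show "truncate \<phi> n \<in> borel_measurable (\<mu> x)" for n using b[of n] by measurable
    show "AE t in \<mu> x. (\<lambda>n. truncate \<phi> n t) \<longlonglongrightarrow> \<phi> t" by (simp add: truncate_tendsto)
    have "cmod (truncate \<phi> n t) \<le> 1 + (cmod (\<phi> t))\<^sup>2" for n t
    proof -
      have "0 \<le> (cmod (\<phi> t) - 1)\<^sup>2" by simp
      then have "2 * cmod (\<phi> t) \<le> 1 + (cmod (\<phi> t))\<^sup>2" by (simp add: power2_diff)
      then show ?thesis using cmod_truncate_le[of \<phi> n t] by (smt (verit) norm_ge_zero)
    qed
    then show "AE t in \<mu> x. norm (truncate \<phi> n t) \<le> 1 + (cmod (\<phi> t))\<^sup>2" for n by simp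
  qed
  moreover have "f + c *\<^sub>C g \<in> spectral_dom E UNIV \<phi>" for c
  proof -
    note lin = bounded_clinearD[OF bcalc_clinear[OF b]]
    obtain a where a: "(\<lambda>n. bcalc E (truncate \<phi> n) f) \<longlonglongrightarrow> a"
      using f by (auto simp: spectral_dom_iff[OF \<phi>] convergent_def)
    obtain b where b: "(\<lambda>n. bcalc E (truncate \<phi> n) g) \<longlonglongrightarrow> b"
      using g by (auto simp: spectral_dom_iff[OF \<phi>] convergent_def)
    have "(\<lambda>n. bcalc E (truncate \<phi> n) f + c *\<^sub>C bcalc E (truncate \<phi> n) g) \<longlonglongrightarrow> a + c *\<^sub>C b"
      using bounded_clinear_tendsto[OF bcalc_clinear b, of "\<lambda>_. c"] by (intro tendsto_add a) (simp add: bcalc_const)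
    then show ?thesis
      by (intro spectral_dom_if_tendsto[OF \<phi>]) (simp add: lin)
  qed
  ultimately have "(\<lambda>n. (\<Sum>k<4. \<i> ^ k * (LINT t|\<mu> (f + \<i> ^ k *\<^sub>C g). truncate \<phi> n t)) / 4)
      \<longlonglongrightarrow> spectral_form E UNIV \<phi> g f"
    unfolding spectral_form_UNIV by (intro tendsto_intros) auto
  then show ?thesis by (simp add: cinner_bcalc[OF b] spectral_form_UNIV)
qed

lemma bcalc_truncate_bcalc_tendsto:
  assumes \<phi>: "\<phi> \<in> borel_measurable borel" and \<psi>: "bounded_borel \<psi>"
    and \<phi>\<psi>: "bounded_borel (\<lambda>t. \<phi> t * \<psi> t)"
  shows "(\<lambda>n. bcalc E (truncate \<phi> n) (bcalc E \<psi> f)) \<longlonglongrightarrow> bcalc E (\<lambda>t. \<phi> t * \<psi> t) f"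
proof -
  obtain M where M: "\<And>t. cmod (\<phi> t * \<psi> t) \<le> M" using bounded_borel_bound[OF \<phi>\<psi>] by metis
  have "(\<lambda>n. bcalc E (\<lambda>t. truncate \<phi> n t * \<psi> t) f) \<longlonglongrightarrow> bcalc E (\<lambda>t. \<phi> t * \<psi> t) f"
  proof (rule bcalc_tendsto[where M = M])
    show "cmod (truncate \<phi> n t * \<psi> t) \<le> M" for n t
      using M[of t] order_trans[OF norm_ge_zero M[of t]] by (simp add: truncate_def)
  qed (use \<phi>\<psi> \<psi> in \<open>auto intro: bounded_borel_mult bounded_borel_truncate[OF \<phi>] tendsto_mult_right truncate_tendsto\<close>)
  then show ?thesis by (simp add: bcalc_mult[OF bounded_borel_truncate[OF \<phi>] \<psi>])
qed

text \<open>In this form a spectral integral no longer mentions its domain or its sesquilinear form. The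
  domain is dense because it contains the vectors \<open>bcalc E (indicator {t. cmod (\<phi> t) \<le> n}) g\<close>.\<close>

theorem mem_spectral_integral_iff:
  assumes \<phi>: "\<phi> \<in> borel_measurable borel"
  shows "(f, h) \<in> spectral_integral E UNIV \<phi> \<longleftrightarrow> (\<lambda>n. bcalc E (truncate \<phi> n) f) \<longlonglongrightarrow> h"
proof
  assume h: "(\<lambda>n. bcalc E (truncate \<phi> n) f) \<longlonglongrightarrow> h"
  then have f: "f \<in> spectral_dom E UNIV \<phi>" by (rule spectral_dom_if_tendsto[OF \<phi>])
  have "cinner g h = spectral_form E UNIV \<phi> g f" if "g \<in> spectral_dom E UNIV \<phi>" for g
    using LIMSEQ_unique[OF tendsto_cinner_right[OF h] spectral_form_tendsto[OF \<phi> f that]] .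
  with f show "(f, h) \<in> spectral_integral E UNIV \<phi>" by (simp add: spectral_integral_def)
next
  assume "(f, h) \<in> spectral_integral E UNIV \<phi>"
  then have f: "f \<in> spectral_dom E UNIV \<phi>"
    and h: "\<And>g. g \<in> spectral_dom E UNIV \<phi> \<Longrightarrow> cinner g h = spectral_form E UNIV \<phi> g f"
    by (auto simp: spectral_integral_def)
  obtain k where k: "(\<lambda>n. bcalc E (truncate \<phi> n) f) \<longlonglongrightarrow> k"
    using f by (auto simp: spectral_dom_iff[OF \<phi>] convergent_def)
  have eq: "cinner g h = cinner g k" if "g \<in> spectral_dom E UNIV \<phi>" for g
    using LIMSEQ_unique[OF tendsto_cinner_right[OF k] spectral_form_tendsto[OF \<phi> f that]] h[OF that] by simp
  have "h = k"
  proof (rule cinner_eqI)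
    fix g
    let ?K = "\<lambda>n. {t. cmod (\<phi> t) \<le> real n}"
    have K: "bounded_borel (indicator (?K n))" for n
      using \<phi> by (intro bounded_borel_indicator) measurable
    have "bcalc E (indicator (?K n)) g \<in> spectral_dom E UNIV \<phi>" for n
      by (rule spectral_dom_if_tendsto[OF \<phi>], rule bcalc_truncate_bcalc_tendsto[OF \<phi> K])
        (use bounded_borel_truncate[OF \<phi>, of n] in \<open>simp add: truncate_eq_indicator\<close>)
    note dense = eq[OF this]
    have "(\<lambda>n. bcalc E (indicator (?K n)) g) \<longlonglongrightarrow> bcalc E (\<lambda>t. 1) g"
    proof (rule bcalc_tendsto[where M = 1])
      fix t
      obtain N where "cmod (\<phi> t) \<le> real N" using real_arch_simple by blast
      then have "\<forall>\<^sub>F n in sequentially. indicator (?K n) t = (1::complex)"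
        by (intro eventually_sequentiallyI[of N]) (auto simp: indicator_def)
      then show "(\<lambda>n. indicator (?K n) t) \<longlonglongrightarrow> (1::complex)" by (rule tendsto_eventually)
    qed (use K in \<open>auto simp: indicator_def\<close>)
    then have lim: "(\<lambda>n. bcalc E (indicator (?K n)) g) \<longlonglongrightarrow> g" by (simp add: bcalc_one)
    show "cinner g h = cinner g k"
      using LIMSEQ_unique[OF tendsto_cinner_left[OF lim, of h]] tendsto_cinner_left[OF lim, of k]
      by (simp add: dense)
  qed
  with k show "(\<lambda>n. bcalc E (truncate \<phi> n) f) \<longlonglongrightarrow> h" by simp
qed

lemma spectral_integral_bounded:
  assumes "bounded_borel \<phi>"
  shows "spectral_integral E UNIV \<phi> = graph (bcalc E \<phi>)"
proof -
  have \<phi>: "\<phi> \<in> borel_measurable borel" using assms by measurable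
  have "(\<lambda>n. bcalc E (truncate \<phi> n) f) \<longlonglongrightarrow> bcalc E \<phi> f" for f
    using bcalc_truncate_bcalc_tendsto[OF \<phi>, of "\<lambda>t. 1" f] assms by (simp add: bcalc_one)
  then have "(f, h) \<in> spectral_integral E UNIV \<phi> \<longleftrightarrow> h = bcalc E \<phi> f" for f h
    using LIMSEQ_unique by (auto simp: mem_spectral_integral_iff[OF \<phi>])
  then show ?thesis unfolding graph_def by auto
qed

lemma bcalc_mem_spectral_integral:
  assumes "\<phi> \<in> borel_measurable borel" "bounded_borel \<psi>" "bounded_borel (\<lambda>t. \<phi> t * \<psi> t)"
  shows "(bcalc E \<psi> f, bcalc E (\<lambda>t. \<phi> t * \<psi> t) f) \<in> spectral_integral E UNIV \<phi>"
  using bcalc_truncate_bcalc_tendsto[OF assms] by (simp add: mem_spectral_integral_iff[OF assms(1)])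

lemma bcalc_spectral_integral:
  assumes \<phi>: "\<phi> \<in> borel_measurable borel" and \<psi>: "bounded_borel \<psi>"
    and \<phi>\<psi>: "bounded_borel (\<lambda>t. \<phi> t * \<psi> t)" and fh: "(f, h) \<in> spectral_integral E UNIV \<phi>"
  shows "bcalc E \<psi> h = bcalc E (\<lambda>t. \<phi> t * \<psi> t) f"
proof (rule LIMSEQ_unique)
  have "(\<lambda>n. bcalc E (truncate \<phi> n) f) \<longlonglongrightarrow> h" using fh by (simp add: mem_spectral_integral_iff[OF \<phi>])
  then show "(\<lambda>n. bcalc E \<psi> (bcalc E (truncate \<phi> n) f)) \<longlonglongrightarrow> bcalc E \<psi> h"
    by (rule bounded_clinear_tendsto[OF bcalc_clinear[OF \<psi>]])
  show "(\<lambda>n. bcalc E \<psi> (bcalc E (truncate \<phi> n) f)) \<longlonglongrightarrow> bcalc E (\<lambda>t. \<phi> t * \<psi> t) f"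
    using bcalc_truncate_bcalc_tendsto[OF \<phi> \<psi> \<phi>\<psi>]
    by (simp add: bcalc_mult bounded_borel_truncate[OF \<phi>] \<psi> mult.commute)
qed

text \<open>If \<open>\<phi> \<psi> = 1\<close> up to a null set, the possibly unbounded operator of \<open>\<phi>\<close> is the inverse of the bounded
  operator of \<open>\<psi>\<close>.\<close>

lemma spectral_integral_inverse:
  assumes \<phi>: "\<phi> \<in> borel_measurable borel" and \<psi>: "bounded_borel \<psi>"
    and \<phi>\<psi>: "bounded_borel (\<lambda>t. \<phi> t * \<psi> t)" and inv: "bcalc E (\<lambda>t. \<phi> t * \<psi> t) = (\<lambda>x. x)"
  shows "(f, h) \<in> spectral_integral E UNIV \<phi> \<longleftrightarrow> f = bcalc E \<psi> h"
  using bcalc_mem_spectral_integral[OF \<phi> \<psi> \<phi>\<psi>, of h] bcalc_spectral_integral[OF \<phi> \<psi> \<phi>\<psi>, of f h]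
  unfolding inv by metis

lemma norm_bcalc_indicator_sq:
  assumes "A \<in> sets borel"
  shows "(norm (bcalc E (indicator A) f))\<^sup>2 = measure (\<mu> f) A"
proof -
  have "(LINT t|\<mu> f. (cmod (indicator A t))\<^sup>2) = (LINT t|\<mu> f. indicator A t)"
    by (intro Bochner_Integration.integral_cong) (auto simp: indicator_def)
  then show ?thesis using assms by (simp add: norm_bcalc_sq bounded_borel_indicator)
qed

definition spectral_null :: "real set \<Rightarrow> bool" where
  "spectral_null A \<longleftrightarrow> (\<forall>f. A \<in> null_sets (\<mu> f))"

lemma spectral_nullI:
  assumes "A \<in> sets borel" "\<And>f. bcalc E (indicator A) f = 0"
  shows "spectral_null A"
proof -
  have "measure (\<mu> f) A = 0" for f using norm_bcalc_indicator_sq[OF assms(1), of f] assms(2) by simp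
  then show ?thesis using assms(1)
    by (auto simp: spectral_null_def null_sets_def finite_measure.emeasure_eq_measure[OF finite_measure_\<mu>])
qed

lemma spectral_null_subset: "spectral_null A \<Longrightarrow> B \<in> sets borel \<Longrightarrow> B \<subseteq> A \<Longrightarrow> spectral_null B"
  unfolding spectral_null_def by (metis null_sets_subset sets_spectral_measure)

lemma bcalc_cong_null:
  assumes "bounded_borel \<phi>" "bounded_borel \<psi>" "spectral_null A" "\<And>t. t \<notin> A \<Longrightarrow> \<phi> t = \<psi> t"
  shows "bcalc E \<phi> = bcalc E \<psi>"
proof (rule bcalc_eqI[OF bcalc_clinear[OF assms(2)]])
  fix f
  have "\<psi> t = \<phi> t \<or> t \<in> A" for t using assms(4) by metis
  then have "AE t in \<mu> f. \<psi> t = \<phi> t"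
    using assms(3) by (intro AE_I'[of A]) (auto simp: spectral_null_def)
  moreover have "\<phi> \<in> borel_measurable (\<mu> f)" "\<psi> \<in> borel_measurable (\<mu> f)"
    using assms(1,2) by measurable
  ultimately show "cinner f (bcalc E \<psi> f) = (LINT t|\<mu> f. \<phi> t)"
    unfolding cinner_bcalc_self[OF assms(2)] by (intro integral_cong_AE)
qed

lemma bcalc_indicator_full:
  assumes "spectral_null (- A)" "A \<in> sets borel"
  shows "bcalc E (indicator A) = (\<lambda>x. x)"
  using bcalc_cong_null[OF bounded_borel_indicator[OF assms(2)] bounded_borel_const assms(1), of 1]
  by (simp add: bcalc_one)

end

section \<open>The spectrum as the support of the spectral family\<close>

lemma mem_op_shift_iff: "(f, h) \<in> op_shift T z \<longleftrightarrow> (f, h + z *\<^sub>C f) \<in> T"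
  unfolding op_shift_def by (auto intro!: exI[of _ "h + z *\<^sub>C f"])

lemma op_inv_eq_graph_iff: "op_inv T = graph B \<longleftrightarrow> (\<forall>f h. (f, h) \<in> T \<longleftrightarrow> f = B h)"
  unfolding op_inv_def graph_def by (auto simp: set_eq_iff)

locale operator_calculus = spectral_calculus E
  for E :: "real \<Rightarrow> 'a::chilbert_space \<Rightarrow> 'a" +
  fixes H0 :: "'a operator"
  assumes H0_eq: "H0 = spectral_integral E UNIV complex_of_real"
begin

abbreviation S :: "real set" where "S \<equiv> real_spectrum H0"

lemma of_real_measurable: "complex_of_real \<in> borel_measurable borel"
  by measurable

lemma near_measurable: "{t. cmod (complex_of_real t - z) < \<epsilon>} \<in> sets borel"
  by measurable

text \<open>Cut off near \<open>z\<close>, the function \<open>1 / (t - z)\<close> is bounded and inverts \<open>t - z\<close> up to a null set.\<close>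

lemma mem_resolvent_if_null_nbhd:
  assumes \<epsilon>: "0 < \<epsilon>" and null: "spectral_null {t. cmod (complex_of_real t - z) < \<epsilon>}"
  shows "z \<in> resolvent_set H0"
proof -
  let ?A = "{t. cmod (complex_of_real t - z) < \<epsilon>}"
  define \<psi> where "\<psi> t = indicator (- ?A) t / (complex_of_real t - z)" for t
  have A: "- ?A \<in> sets borel" using near_measurable by (rule borel_comp)
  have \<psi>: "bounded_borel \<psi>"
  proof (rule bounded_borelI[where M = "1 / \<epsilon>"])
    show "\<psi> \<in> borel_measurable borel" unfolding \<psi>_def using A by measurable
    show "cmod (\<psi> t) \<le> 1 / \<epsilon>" for t
      using \<epsilon> by (auto simp: \<psi>_def norm_divide indicator_def intro!: frac_le)
  qed
  have eq: "(\<lambda>t. complex_of_real t * \<psi> t) = (\<lambda>t. indicator (- ?A) t + z * \<psi> t)"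
  proof
    fix t
    show "complex_of_real t * \<psi> t = indicator (- ?A) t + z * \<psi> t"
    proof (cases "t \<in> ?A")
      case False
      then have "complex_of_real t - z \<noteq> 0" using \<epsilon> by auto
      then show ?thesis using False by (simp add: \<psi>_def field_simps)
    qed (simp add: \<psi>_def)
  qed
  note i = bounded_borel_indicator[OF A] and z\<psi> = bounded_borel_scale[OF \<psi>, of z]
  have t\<psi>: "bounded_borel (\<lambda>t. complex_of_real t * \<psi> t)"
    unfolding eq by (intro bounded_borel_add i z\<psi>)
  have calc: "bcalc E (\<lambda>t. complex_of_real t * \<psi> t) f = f + z *\<^sub>C bcalc E \<psi> f" for f
    unfolding eq bcalc_add[OF i z\<psi>] bcalc_scale[OF \<psi>]
    using bcalc_indicator_full[OF _ A] null by simp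
  have "(f, h) \<in> op_shift H0 z \<longleftrightarrow> f = bcalc E \<psi> h" for f h
  proof
    assume "f = bcalc E \<psi> h"
    then show "(f, h) \<in> op_shift H0 z"
      using bcalc_mem_spectral_integral[OF of_real_measurable \<psi> t\<psi>, of h]
      by (simp add: mem_op_shift_iff H0_eq calc)
  next
    assume "(f, h) \<in> op_shift H0 z"
    then have "(f, h + z *\<^sub>C f) \<in> spectral_integral E UNIV complex_of_real"
      by (simp add: mem_op_shift_iff H0_eq)
    from bcalc_spectral_integral[OF of_real_measurable \<psi> t\<psi> this]
    show "f = bcalc E \<psi> h"
      by (simp add: calc bounded_clinearD[OF bcalc_clinear[OF \<psi>]])
  qed
  then have "op_inv (op_shift H0 z) = graph (bcalc E \<psi>)" by (simp add: op_inv_eq_graph_iff)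
  then show ?thesis using bcalc_clinear[OF \<psi>] unfolding resolvent_set_def by blast
qed

text \<open>On the range of the spectral projection of \<open>{t. cmod (t - z) < \<epsilon>}\<close> the operator \<open>H0 - z\<close> is
  bounded by \<open>\<epsilon>\<close>. If \<open>\<epsilon>\<close> is small compared with the inverse of \<open>H0 - z\<close>, this range is trivial.\<close>

lemma null_nbhd_if_mem_resolvent:
  assumes "z \<in> resolvent_set H0"
  shows "\<exists>\<epsilon>>0. spectral_null {t. cmod (complex_of_real t - z) < \<epsilon>}"
proof -
  obtain B where B: "bounded_clinear B" "op_inv (op_shift H0 z) = graph B"
    using assms unfolding resolvent_set_def by blast
  obtain K where K: "0 < K" "\<And>x. norm (B x) \<le> K * norm x" using bounded_clinear_bound[OF B(1)] by metis
  \<comment> \<open>With this \<open>\<epsilon>\<close> the projection \<open>P\<close> below satisfies \<open>\<parallel>P f\<parallel> \<le> K \<epsilon> \<parallel>P f\<parallel> = \<parallel>P f\<parallel> / 2\<close>.\<close>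
  define \<epsilon> where "\<epsilon> = 1 / (2 * K)"
  have \<epsilon>: "0 < \<epsilon>" using K by (simp add: \<epsilon>_def)
  let ?A = "{t. cmod (complex_of_real t - z) < \<epsilon>}"
  note A = near_measurable[of z \<epsilon>]
  have i: "bounded_borel (indicator ?A)" by (rule bounded_borel_indicator[OF A])
  have d: "bounded_borel (\<lambda>t. (complex_of_real t - z) * indicator ?A t)"
    by (rule bounded_borelI[where M = \<epsilon>]) (use A \<epsilon> in \<open>measurable, auto simp: indicator_def\<close>)
  have eq: "(\<lambda>t. complex_of_real t * indicator ?A t) =
      (\<lambda>t. (complex_of_real t - z) * indicator ?A t + z * indicator ?A t)"
    by (auto simp: algebra_simps)
  have t: "bounded_borel (\<lambda>t. complex_of_real t * indicator ?A t)"
    unfolding eq by (intro bounded_borel_add d bounded_borel_scale i)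
  have "bcalc E (indicator ?A) f = 0" for f
  proof -
    let ?P = "bcalc E (indicator ?A)" and ?D = "bcalc E (\<lambda>t. (complex_of_real t - z) * indicator ?A t)"
    have "(?P f, bcalc E (\<lambda>t. complex_of_real t * indicator ?A t) f) \<in> H0"
      unfolding H0_eq by (rule bcalc_mem_spectral_integral[OF of_real_measurable i t])
    then have "(?P f, ?D f + z *\<^sub>C ?P f) \<in> H0"
      unfolding eq by (simp add: bcalc_add[OF d bounded_borel_scale[OF i]] bcalc_scale[OF i])
    then have "?P f = B (?D f)"
      using B(2) by (simp add: op_inv_eq_graph_iff mem_op_shift_iff)
    moreover have "?D f = ?D (?P f)"
      unfolding bcalc_mult[OF d i] by (rule arg_cong[where f = "\<lambda>\<phi>. bcalc E \<phi> f"]) (auto simp: indicator_def)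
    ultimately have "norm (?P f) \<le> K * norm (?D (?P f))" using K(2)[of "?D (?P f)"] by simp
    also have "\<dots> \<le> K * (\<epsilon> * norm (?P f))"
      using K(1) \<epsilon> by (intro mult_left_mono norm_bcalc_le d) (auto simp: indicator_def)
    also have "\<dots> = norm (?P f) / 2" using K(1) by (simp add: \<epsilon>_def)
    finally show ?thesis by simp
  qed
  then have "spectral_null ?A" by (rule spectral_nullI[OF A])
  with \<epsilon> show ?thesis by blast
qed

text \<open>Thus the real spectrum is the support of \<open>E\<close>. In particular it is closed and has a null complement.\<close>

lemma mem_spectrum_compl_iff: "t \<in> - S \<longleftrightarrow> (\<exists>U. open U \<and> spectral_null U \<and> t \<in> U)"
proof
  assume "t \<in> - S"
  then have "complex_of_real t \<in> resolvent_set H0" by (simp add: real_spectrum_def spectrum_def)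
  then obtain \<epsilon> where \<epsilon>: "0 < \<epsilon>" "spectral_null {s. cmod (complex_of_real s - complex_of_real t) < \<epsilon>}"
    using null_nbhd_if_mem_resolvent by blast
  have "{s. cmod (complex_of_real s - complex_of_real t) < \<epsilon>} = ball t \<epsilon>"
    by (auto simp: dist_norm simp flip: of_real_diff)
  with \<epsilon> show "\<exists>U. open U \<and> spectral_null U \<and> t \<in> U" by (metis centre_in_ball open_ball)
next
  assume "\<exists>U. open U \<and> spectral_null U \<and> t \<in> U"
  then obtain U where U: "open U" "spectral_null U" "t \<in> U" by blast
  then obtain \<epsilon> where \<epsilon>: "0 < \<epsilon>" "ball t \<epsilon> \<subseteq> U" using openE by blast
  have "{s. cmod (complex_of_real s - complex_of_real t) < \<epsilon>} = ball t \<epsilon>"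
    by (auto simp: dist_norm simp flip: of_real_diff)
  then have "complex_of_real t \<in> resolvent_set H0"
    using spectral_null_subset[OF U(2) _ \<epsilon>(2)] \<epsilon>(1) by (intro mem_resolvent_if_null_nbhd[of \<epsilon>]) auto
  then show "t \<in> - S" by (simp add: real_spectrum_def spectrum_def)
qed

lemma spectrum_compl_eq: "- S = \<Union>{U. open U \<and> spectral_null U}"
  using mem_spectrum_compl_iff by blast

lemma closed_spectrum: "closed S"
  unfolding closed_def spectrum_compl_eq by (rule open_Union) simp

lemma spectrum_borel: "S \<in> sets borel"
  using closed_spectrum by simp

text \<open>By the Lindelof property countably many of the null sets suffice.\<close>

lemma spectrum_full: "spectral_null (- S)"
proof -
  obtain F where F: "F \<subseteq> {U. open U \<and> spectral_null U}" "countable F" "\<Union>F = \<Union>{U. open U \<and> spectral_null U}"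
    using Lindelof[of "{U. open U \<and> spectral_null U}"] by blast
  have "(\<Union>U\<in>F. U) \<in> null_sets (\<mu> f)" for f
    using F(1,2) by (intro null_sets_UN') (auto simp: spectral_null_def)
  then show ?thesis using F(3) by (simp add: spectral_null_def spectrum_compl_eq)
qed

text \<open>For a nonreal \<open>z\<close> the gap is the distance to the real axis; for a real \<open>z\<close> it exists because the
  spectrum is closed.\<close>

lemma spectrum_gap:
  assumes "z \<in> resolvent_set H0"
  obtains \<epsilon> where "0 < \<epsilon>" "\<And>t. t \<in> S \<Longrightarrow> \<epsilon> \<le> cmod (complex_of_real t - z)"
proof (cases "Im z = 0")
  case True
  then have z: "z = complex_of_real (Re z)" by (simp add: complex_eq_iff)
  then have "Re z \<in> - S" using assms by (simp add: real_spectrum_def spectrum_def)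
  then obtain \<epsilon> where \<epsilon>: "0 < \<epsilon>" "ball (Re z) \<epsilon> \<subseteq> - S"
    using closed_spectrum openE[of "- S" "Re z"] by (auto simp: closed_def)
  have "\<epsilon> \<le> cmod (complex_of_real t - z)" if "t \<in> S" for t
  proof (rule ccontr)
    assume "\<not> ?thesis"
    then have "\<bar>t - Re z\<bar> < \<epsilon>" by (subst (asm) z) (simp flip: of_real_diff)
    then have "t \<in> ball (Re z) \<epsilon>" by (simp add: dist_real_def abs_minus_commute)
    then show False using \<epsilon>(2) that by blast
  qed
  with \<epsilon>(1) show ?thesis using that by blast
next
  case False
  have "\<bar>Im z\<bar> \<le> cmod (complex_of_real t - z)" for t
    using abs_Im_le_cmod[of "complex_of_real t - z"] by simp
  with False show ?thesis using that[of "\<bar>Im z\<bar>"] by simp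
qed

text \<open>On the range of the spectral projection of an interval below \<open>t / 2 < 0\<close> the form of \<open>H0\<close> is at most
  \<open>t / 2\<close> times the squared norm. Nonnegativity of \<open>H0\<close> makes this range trivial.\<close>

lemma negative_mem_resolvent:
  assumes nonneg: "nonneg_op H0" and t: "t < 0"
  shows "complex_of_real t \<in> resolvent_set H0"
proof -
  \<comment> \<open>The interval \<open>(3 t / 2, t / 2)\<close>, which is bounded and stays away from \<open>0\<close>.\<close>
  define A where "A = ball t (- t / 2)"
  have A: "A \<in> sets borel" by (simp add: A_def)
  have s: "s < t / 2" if "s \<in> A" for s
    using that by (auto simp: A_def dist_real_def abs_if split: if_splits)
  have s': "2 * t < s" if "s \<in> A" for s
    using that t by (auto simp: A_def dist_real_def abs_if split: if_splits)
  have abs_s: "\<bar>s\<bar> \<le> 2 * \<bar>t\<bar>" if "s \<in> A" for s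
    using s[OF that] s'[OF that] t by linarith
  have i: "bounded_borel (indicator A)" by (rule bounded_borel_indicator[OF A])
  have si: "bounded_borel (\<lambda>s. complex_of_real s * indicator A s)"
    by (rule bounded_borelI[where M = "2 * \<bar>t\<bar>"])
      (use A t in \<open>measurable, auto simp: indicator_def dest!: abs_s\<close>)
  have "bcalc E (indicator A) f = 0" for f
  proof -
    let ?P = "bcalc E (indicator A)" and ?D = "bcalc E (\<lambda>s. complex_of_real s * indicator A s)"
    have "(?P f, ?D f) \<in> H0"
      unfolding H0_eq by (rule bcalc_mem_spectral_integral[OF of_real_measurable i si])
    then have "0 \<le> Re (cinner (?P f) (?D f))" using nonneg unfolding nonneg_op_def by blast
    also have "cinner (?P f) (?D f) = cinner f (bcalc E (\<lambda>s. complex_of_real (s * indicator A s)) f)"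
    proof -
      have c: "(\<lambda>s. cnj (indicator A s)) = (indicator A :: real \<Rightarrow> complex)"
        by (auto simp: indicator_def)
      have m: "(\<lambda>s. indicator A s * (complex_of_real s * indicator A s)) =
          (\<lambda>s. complex_of_real (s * indicator A s))"
        by (auto simp: indicator_def)
      show ?thesis
        using bcalc_adjoint[OF i, of f "?D f"] by (simp only: c bcalc_mult[OF i si] m)
    qed
    also have "\<dots> = complex_of_real (LINT s|\<mu> f. s * indicator A s)"
    proof -
      have "bounded_borel (\<lambda>s. complex_of_real (s * indicator A s))"
        by (rule bounded_borelI[where M = "2 * \<bar>t\<bar>"])
          (use A t in \<open>measurable, auto simp: indicator_def dest!: abs_s\<close>)
      then show ?thesis by (simp only: cinner_bcalc_self integral_complex_of_real)
    qed
    also have "Re \<dots> \<le> (LINT s|\<mu> f. t / 2 * indicator A s)"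
      unfolding Re_complex_of_real
    proof (rule integral_mono)
      show "integrable (\<mu> f) (\<lambda>s. s * indicator A s)"
        by (rule finite_measure.integrable_const_bound[OF finite_measure_\<mu>, where B = "2 * \<bar>t\<bar>"])
          (use A t in \<open>auto simp: indicator_def dest!: abs_s\<close>)
      show "integrable (\<mu> f) (\<lambda>s. t / 2 * indicator A s)"
        using A finite_measure.emeasure_finite[OF finite_measure_\<mu>]
        by (auto simp: top.not_eq_extremum)
    qed (auto simp: indicator_def dest: s)
    also have "\<dots> = t / 2 * (norm (?P f))\<^sup>2"
      using A by (simp add: norm_bcalc_indicator_sq)
    finally show ?thesis using t by (simp add: zero_le_mult_iff)
  qed
  then have "spectral_null A" by (rule spectral_nullI[OF A])
  then have "t \<in> - S" using t unfolding mem_spectrum_compl_iff by (intro exI[of _ A]) (simp add: A_def)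
  then show ?thesis by (simp add: real_spectrum_def spectrum_def)
qed

end

section \<open>Square roots and the operators \<open>A(z)\<close>\<close>

lemma zsqrt_cmod: "cmod (zsqrt z) = sqrt (cmod z)"
  by (simp add: zsqrt_def norm_mult)

lemma zsqrt_mult_self: "zsqrt z * zsqrt z = z"
proof -
  have "zsqrt z * zsqrt z = of_real (sqrt (cmod z) * sqrt (cmod z)) * (exp (\<i> * of_real (Arg2pi z / 2)))\<^sup>2"
    by (simp only: zsqrt_def power2_eq_square of_real_mult mult_ac)
  also have "(exp (\<i> * of_real (Arg2pi z / 2)))\<^sup>2 = exp (\<i> * of_real (Arg2pi z))"
    by (simp flip: exp_double)
  also have "sqrt (cmod z) * sqrt (cmod z) = cmod z" by simp
  finally show ?thesis using Arg2pi_eq[of z] by simp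
qed

lemma zsqrt_eq_0_iff: "zsqrt z = 0 \<longleftrightarrow> z = 0"
proof -
  have "cmod (zsqrt z) = 0 \<longleftrightarrow> cmod z = 0" unfolding zsqrt_cmod by simp
  then show ?thesis by (simp only: norm_eq_zero)
qed

text \<open>Comparing the branch with the principal square root yields measurability from the explicit real and
  imaginary parts of the latter.\<close>

lemma zsqrt_eq_csqrt: "zsqrt z = (if 0 \<le> Im z then csqrt z else - csqrt z)"
proof (cases "z = 0")
  case False
  define a where "a = Arg2pi z"
  have a: "0 \<le> a" "a < 2 * pi" using Arg2pi[of z] by (auto simp: a_def)
  have Re: "Re (zsqrt z) = sqrt (cmod z) * cos (a / 2)" and Im: "Im (zsqrt z) = sqrt (cmod z) * sin (a / 2)"
    by (simp_all add: zsqrt_def a_def Re_exp Im_exp)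
  have z: "(zsqrt z)\<^sup>2 = z" by (simp add: power2_eq_square zsqrt_mult_self)
  show ?thesis
  proof (cases "0 \<le> Im z")
    case True
    then have "a \<le> pi" by (simp add: a_def Arg2pi_le_pi)
    then have "0 \<le> Re (zsqrt z)" "0 \<le> Im (zsqrt z)"
      unfolding Re Im using a by (auto intro!: mult_nonneg_nonneg cos_ge_zero sin_ge_zero)
    then have "csqrt ((zsqrt z)\<^sup>2) = zsqrt z" by (intro csqrt_square) linarith
    then show ?thesis using True z by simp
  next
    case Im_neg: False
    then have "pi < a" using Arg2pi_le_pi[of z] by (simp add: a_def)
    then have "cos (a / 2) < 0" using a by (intro cos_lt_zero_pi) auto
    then have "0 < Re (- zsqrt z)"
      using False by (simp add: Re mult_pos_neg)
    then have "csqrt ((- zsqrt z)\<^sup>2) = - zsqrt z" by (intro csqrt_square) simp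
    then show ?thesis using Im_neg z by simp
  qed
qed (simp add: zsqrt_def)

lemma zsqrt_measurable: "(\<lambda>t. zsqrt (complex_of_real t - z)) \<in> borel_measurable borel"
proof -
  have "(\<lambda>t. csqrt (complex_of_real t - z)) \<in> borel_measurable borel"
    unfolding borel_measurable_complex_iff csqrt.sel by measurable
  then show ?thesis unfolding zsqrt_eq_csqrt by (cases "0 \<le> Im (- z)") auto
qed

lemma op_app_graph: "op_app (graph T) x = T x"
  by (simp add: op_app_def graph_def)

context operator_calculus
begin

text \<open>The symbols of \<open>(H0 - z)\<^sup>-\<^sup>1\<^sup>/\<^sup>2\<close> and of \<open>(H0 - z)\<^sup>1\<^sup>/\<^sup>2 (H0 - w)\<^sup>-\<^sup>1\<^sup>/\<^sup>2\<close>. The indicator makes them bounded on the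
  whole line.\<close>

definition inv_root :: "complex \<Rightarrow> real \<Rightarrow> complex" where
  "inv_root z t = indicator S t / zsqrt (complex_of_real t - z)"

definition root_quot :: "complex \<Rightarrow> complex \<Rightarrow> real \<Rightarrow> complex" where
  "root_quot z w t = indicator S t * zsqrt (complex_of_real t - z) / zsqrt (complex_of_real t - w)"

lemma root_measurable [measurable]:
  "(\<lambda>t. indicator S t * zsqrt (complex_of_real t - z)) \<in> borel_measurable borel"
  "inv_root z \<in> borel_measurable borel"
  "root_quot z w \<in> borel_measurable borel"
  using spectrum_borel zsqrt_measurable unfolding inv_root_def[abs_def] root_quot_def[abs_def]
  by measurable

lemma zsqrt_nonzero:
  assumes "z \<in> resolvent_set H0" "t \<in> S"
  shows "zsqrt (complex_of_real t - z) \<noteq> 0"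
proof -
  have "complex_of_real t \<noteq> z" using assms by (auto simp: real_spectrum_def spectrum_def)
  then show ?thesis by (simp add: zsqrt_eq_0_iff)
qed

lemma bounded_inv_root:
  assumes "z \<in> resolvent_set H0"
  shows "bounded_borel (inv_root z)"
proof -
  obtain \<epsilon> where \<epsilon>: "0 < \<epsilon>" "\<And>t. t \<in> S \<Longrightarrow> \<epsilon> \<le> cmod (complex_of_real t - z)"
    using spectrum_gap[OF assms] by blast
  show ?thesis
    by (rule bounded_borelI[where M = "1 / sqrt \<epsilon>"])
      (use \<epsilon> in \<open>auto simp: inv_root_def norm_divide zsqrt_cmod indicator_def root_measurable intro!: frac_le\<close>)
qed

text \<open>The gap \<open>\<epsilon>\<close> at \<open>w\<close> gives \<open>\<bar>t - z\<bar> \<le> (1 + \<bar>w - z\<bar> / \<epsilon>) \<bar>t - w\<bar>\<close> on the spectrum. The point \<open>z\<close> is arbitrary;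
  with \<open>z = 0\<close> this compares \<open>H0\<^sup>1\<^sup>/\<^sup>2\<close> with \<open>(H0 - w)\<^sup>1\<^sup>/\<^sup>2\<close>.\<close>

lemma bounded_root_quot:
  assumes "w \<in> resolvent_set H0"
  shows "bounded_borel (root_quot z w)"
proof -
  obtain \<epsilon> where \<epsilon>: "0 < \<epsilon>" "\<And>t. t \<in> S \<Longrightarrow> \<epsilon> \<le> cmod (complex_of_real t - w)"
    using spectrum_gap[OF assms] by blast
  let ?M = "1 + cmod (w - z) / \<epsilon>"
  have M: "0 \<le> ?M" using \<epsilon> by simp
  show ?thesis
  proof (rule bounded_borelI[where M = "sqrt ?M"])
    fix t
    show "cmod (root_quot z w t) \<le> sqrt ?M"
    proof (cases "t \<in> S")
      case True
      have pos: "0 < cmod (complex_of_real t - w)" using \<epsilon> True by fastforce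
      have "cmod (complex_of_real t - z) \<le> cmod (complex_of_real t - w) + cmod (w - z)"
        using norm_triangle_ineq[of "complex_of_real t - w" "w - z"] by simp
      also have "\<dots> \<le> ?M * cmod (complex_of_real t - w)"
        using \<epsilon>(1) mult_left_mono[OF \<epsilon>(2)[OF True] norm_ge_zero[of "w - z"]] by (simp add: field_simps)
      finally have "cmod (complex_of_real t - z) / cmod (complex_of_real t - w) \<le> ?M"
        using pos by (simp add: divide_le_eq)
      then show ?thesis
        using True by (simp add: root_quot_def norm_divide zsqrt_cmod real_sqrt_divide[symmetric])
    qed (use M in \<open>simp add: root_quot_def\<close>)
  qed (rule root_measurable)
qed

abbreviation r :: "complex \<Rightarrow> 'a \<Rightarrow> 'a" where "r z \<equiv> bcalc E (inv_root z)"
abbreviation r_adj :: "complex \<Rightarrow> 'a \<Rightarrow> 'a" where "r_adj z \<equiv> bcalc E (\<lambda>t. cnj (inv_root z t))"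
abbreviation U :: "complex \<Rightarrow> complex \<Rightarrow> 'a \<Rightarrow> 'a" where "U z w \<equiv> bcalc E (root_quot z w)"

lemma bcalc_S: "bcalc E (indicator S) = (\<lambda>x. x)"
  by (rule bcalc_indicator_full[OF spectrum_full spectrum_borel])

lemma inv_sqrt_op_eq: "z \<in> resolvent_set H0 \<Longrightarrow> inv_sqrt_op H0 E z = graph (r z)"
  unfolding inv_sqrt_op_def spectral_integral_restrict[of _ S]
  using spectral_integral_bounded[OF bounded_inv_root, of z]
  by (simp add: inv_root_def[abs_def] divide_inverse)

lemma sqrt_mult_inv_root:
  "z \<in> resolvent_set H0 \<Longrightarrow>
    (\<lambda>t. indicator S t * zsqrt (complex_of_real t - z) * inv_root z t) = indicator S"
  by (intro ext, case_tac "t \<in> S") (auto simp: inv_root_def zsqrt_nonzero)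

text \<open>\<open>(H0 - z)\<^sup>1\<^sup>/\<^sup>2\<close> is the inverse of the bounded operator \<open>(H0 - z)\<^sup>-\<^sup>1\<^sup>/\<^sup>2\<close>, because the complement of the
  spectrum is null.\<close>

lemma mem_sqrt_op_iff:
  assumes "z \<in> resolvent_set H0"
  shows "(f, h) \<in> sqrt_op H0 E z \<longleftrightarrow> f = r z h"
  unfolding sqrt_op_def spectral_integral_restrict[of _ S]
  by (rule spectral_integral_inverse[OF root_measurable(1) bounded_inv_root[OF assms]])
    (simp_all add: sqrt_mult_inv_root[OF assms] bounded_borel_indicator spectrum_borel bcalc_S)

lemma single_valued_sqrt_op: "(f, h) \<in> sqrt_op H0 E z \<Longrightarrow> (f, k) \<in> sqrt_op H0 E z \<Longrightarrow> h = k"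
  unfolding sqrt_op_def spectral_integral_restrict[of _ S] mem_spectral_integral_iff[OF root_measurable(1)]
  by (rule LIMSEQ_unique)

lemma op_app_sqrt_op: "(f, h) \<in> sqrt_op H0 E z \<Longrightarrow> op_app (sqrt_op H0 E z) f = h"
  unfolding op_app_def by (rule the_equality, assumption, rule single_valued_sqrt_op)

lemma r_inj:
  assumes "z \<in> resolvent_set H0" "r z x = r z y"
  shows "x = y"
proof (rule single_valued_sqrt_op)
  show "(r z x, x) \<in> sqrt_op H0 E z" "(r z x, y) \<in> sqrt_op H0 E z"
    using assms(2) by (simp_all add: mem_sqrt_op_iff[OF assms(1)])
qed

text \<open>The truncations of \<open>(H0 - z)\<^sup>1\<^sup>/\<^sup>2\<close>, applied to \<open>x\<close>, are preimages of vectors converging to \<open>x\<close>.\<close>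

lemma r_range_dense:
  assumes "z \<in> resolvent_set H0"
  shows "\<exists>X. (\<lambda>n. r z (X n)) \<longlonglongrightarrow> x"
proof -
  note \<phi> = root_measurable(1)[of z] and i = bounded_inv_root[OF assms]
  let ?T = "truncate (\<lambda>t. indicator S t * zsqrt (complex_of_real t - z))"
  have "(\<lambda>n. bcalc E (?T n) (r z x)) \<longlonglongrightarrow> x"
    using bcalc_truncate_bcalc_tendsto[OF \<phi> i, of x]
    by (simp add: sqrt_mult_inv_root[OF assms] bounded_borel_indicator spectrum_borel bcalc_S)
  moreover have "bcalc E (?T n) (r z x) = r z (bcalc E (?T n) x)" for n
    by (simp add: bcalc_mult i bounded_borel_truncate[OF \<phi>] mult.commute)
  ultimately show ?thesis by auto
qed

lemma U_inverse:
  assumes "z \<in> resolvent_set H0" "w \<in> resolvent_set H0"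
  shows "U z w (U w z f) = f"
proof -
  have "(\<lambda>t. root_quot z w t * root_quot w z t) = indicator S"
    by (intro ext, case_tac "t \<in> S") (auto simp: root_quot_def zsqrt_nonzero assms)
  then show ?thesis
    by (simp add: bcalc_mult[OF bounded_root_quot[OF assms(2)] bounded_root_quot[OF assms(1)]] bcalc_S)
qed

lemma inv_root_mult_root_quot:
  assumes "z \<in> resolvent_set H0"
  shows "inv_root z t * root_quot z w t = inv_root w t"
  by (cases "t \<in> S") (simp_all add: root_quot_def inv_root_def zsqrt_nonzero[OF assms])

lemma r_U:
  assumes "z \<in> resolvent_set H0" "w \<in> resolvent_set H0"
  shows "r z (U z w f) = r w f" "U z w (r z f) = r w f"
  using bcalc_mult[OF bounded_inv_root[OF assms(1)] bounded_root_quot[OF assms(2)]]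
    bcalc_mult[OF bounded_root_quot[OF assms(2)] bounded_inv_root[OF assms(1)]]
  by (simp_all add: inv_root_mult_root_quot[OF assms(1)] mult.commute)

text \<open>On the spectrum, \<open>(t - z) / (t - w) = 1 + (w - z) / (t - w)\<close>.\<close>

lemma U_U:
  assumes "z \<in> resolvent_set H0" "w \<in> resolvent_set H0"
  shows "U z w (U z w f) = f + (w - z) *\<^sub>C r w (r w f)"
proof -
  note i = bounded_inv_root[OF assms(2)] and q = bounded_root_quot[OF assms(2), of z]
  have "root_quot z w t * root_quot z w t = indicator S t + (w - z) * (inv_root w t * inv_root w t)" for t
  proof (cases "t \<in> S")
    case True
    let ?z = "complex_of_real t - z" and ?w = "complex_of_real t - w"
    have w: "?w \<noteq> 0" using zsqrt_nonzero[OF assms(2) True] by (simp only: zsqrt_eq_0_iff not_False_eq_True)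
    have "root_quot z w t * root_quot z w t = ?z / ?w"
      using True by (simp add: root_quot_def zsqrt_mult_self)
    also have "\<dots> = 1 + (w - z) * (1 / ?w)" using w by (simp add: field_simps)
    also have "1 / ?w = inv_root w t * inv_root w t"
      using True by (simp add: inv_root_def zsqrt_mult_self)
    finally show ?thesis using True by simp
  qed (simp add: root_quot_def inv_root_def)
  then show ?thesis
    by (simp add: bcalc_mult i q bcalc_add bcalc_scale bounded_borel_indicator spectrum_borel
        bounded_borel_scale bounded_borel_mult bcalc_S)
qed

lemma op_adj_inv_sqrt_op:
  assumes "z \<in> resolvent_set H0"
  shows "op_adj (inv_sqrt_op H0 E z) = graph (r_adj z)"
proof -
  have "(g, h) \<in> op_adj (inv_sqrt_op H0 E z) \<longleftrightarrow> h = r_adj z g" for g h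
  proof -
    have "(g, h) \<in> op_adj (inv_sqrt_op H0 E z) \<longleftrightarrow> (\<forall>f. cinner (r_adj z g) f = cinner h f)"
      by (auto simp: op_adj_def inv_sqrt_op_eq[OF assms] graph_def bcalc_adjoint[OF bounded_inv_root[OF assms]])
    also have "\<dots> \<longleftrightarrow> (\<forall>f. cinner f (r_adj z g) = cinner f h)"
      by (metis cinner_commute)
    also have "\<dots> \<longleftrightarrow> h = r_adj z g" using cinner_eqI by blast
    finally show ?thesis .
  qed
  then show ?thesis by (auto simp: graph_def)
qed

text \<open>\<open>H0\<^sup>1\<^sup>/\<^sup>2\<close> times an operator comparable with \<open>(H0 - z)\<^sup>-\<^sup>1\<^sup>/\<^sup>2\<close> is bounded.\<close>

lemma Hplus_bcalc:
  assumes z: "z \<in> resolvent_set H0" and \<phi>: "bounded_borel \<phi>" and le: "\<And>t. cmod (\<phi> t) = cmod (inv_root z t)"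
  shows "bcalc E \<phi> f \<in> Hplus H0 E" "\<exists>K\<ge>0. \<forall>f. Hplus_norm H0 E (bcalc E \<phi> f) \<le> K * norm f"
proof -
  let ?\<psi> = "\<lambda>t. indicator S t * zsqrt (complex_of_real t - 0) * \<phi> t"
  obtain M where M: "0 < M" "\<And>t. cmod (root_quot 0 z t) \<le> M"
    using bounded_borel_bound[OF bounded_root_quot[OF z]] by metis
  have "cmod (?\<psi> t) = cmod (root_quot 0 z t)" for t
    by (simp add: norm_mult norm_divide le root_quot_def inv_root_def indicator_def)
  then have \<psi>: "bounded_borel ?\<psi>"
    using M(2) \<phi> root_measurable(1)[of 0] by (intro bounded_borelI[where M = M]) auto
  have mem: "(bcalc E \<phi> f, bcalc E ?\<psi> f) \<in> sqrt_op H0 E 0" for f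
    unfolding sqrt_op_def spectral_integral_restrict[of _ S]
    by (rule bcalc_mem_spectral_integral[OF root_measurable(1) \<phi> \<psi>])
  then show "bcalc E \<phi> f \<in> Hplus H0 E" unfolding Hplus_def by blast
  obtain K where K: "0 < K" "\<And>f. norm (bcalc E ?\<psi> f) \<le> K * norm f"
    using bounded_clinear_bound[OF bcalc_clinear[OF \<psi>]] by blast
  obtain L where L: "0 < L" "\<And>f. norm (bcalc E \<phi> f) \<le> L * norm f"
    using bounded_clinear_bound[OF bcalc_clinear[OF \<phi>]] by blast
  have "Hplus_norm H0 E (bcalc E \<phi> f) \<le> (K + L) * norm f" for f
  proof -
    have "Hplus_norm H0 E (bcalc E \<phi> f) = sqrt ((norm (bcalc E ?\<psi> f))\<^sup>2 + (norm (bcalc E \<phi> f))\<^sup>2)"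
      unfolding Hplus_norm_def Hplus_inner_def op_app_sqrt_op[OF mem] by (simp add: cinner_self)
    also have "\<dots> \<le> norm (bcalc E ?\<psi> f) + norm (bcalc E \<phi> f)"
      by (rule sqrt_sum_squares_le_sum) simp_all
    also have "\<dots> \<le> (K + L) * norm f" using K(2)[of f] L(2)[of f] by (simp add: distrib_right)
    finally show ?thesis .
  qed
  then show "\<exists>K\<ge>0. \<forall>f. Hplus_norm H0 E (bcalc E \<phi> f) \<le> K * norm f"
    using K(1) L(1) by (intro exI[of _ "K + L"]) simp
qed

text \<open>The operator \<open>r_adj z\<close> maps boundedly into the form domain, so \<open>x \<mapsto> V (r z f) (r_adj z x)\<close> is a bounded
  conjugate linear functional. The Riesz theorem thus guarantees that the definite description behind
  the extended operator \<open>(H0 - z)\<^sup>-\<^sup>1\<^sup>/\<^sup>2\<close> denotes a vector.\<close>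

lemma cinner_A_op:
  assumes V: "bounded_Hplus_Hminus H0 E V" and z: "z \<in> resolvent_set H0"
  shows "cinner g (A_op H0 E V z f) = - V (r z f) (r_adj z g)"
proof -
  note i = bounded_inv_root[OF z]
  note ci = bounded_borel_cnj[OF i]
  define \<Psi> where "\<Psi> = V (r z f)"
  have "r z f \<in> Hplus H0 E" by (rule Hplus_bcalc[OF z i]) simp
  then have \<Psi>: "\<Psi> \<in> Hminus H0 E" using V unfolding \<Psi>_def bounded_Hplus_Hminus_def by blast
  have plus: "r_adj z x \<in> Hplus H0 E" for x by (rule Hplus_bcalc[OF z ci]) simp
  obtain K where K: "0 \<le> K" "\<And>x. Hplus_norm H0 E (r_adj z x) \<le> K * norm x"
    using Hplus_bcalc(2)[OF z ci] by auto
  obtain C where C: "\<And>x. x \<in> Hplus H0 E \<Longrightarrow> cmod (\<Psi> x) \<le> C * Hplus_norm H0 E x"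
    using \<Psi> unfolding Hminus_def by blast
  note lin = bounded_clinearD[OF bcalc_clinear[OF ci]]
  obtain h where h: "\<And>x. cinner x h = \<Psi> (r_adj z x)"
  proof (rule riesz_representation[of "\<lambda>x. \<Psi> (r_adj z x)" "\<bar>C\<bar> * K"])
    show "\<Psi> (r_adj z (x + y)) = \<Psi> (r_adj z x) + \<Psi> (r_adj z y)" for x y
      using \<Psi> plus[of x] plus[of y] unfolding Hminus_def lin by blast
    show "\<Psi> (r_adj z (c *\<^sub>C x)) = cnj c * \<Psi> (r_adj z x)" for c x
      using \<Psi> plus[of x] unfolding Hminus_def lin by blast
    show "cmod (\<Psi> (r_adj z x)) \<le> \<bar>C\<bar> * K * norm x" for x
    proof -
      have nonneg: "0 \<le> Hplus_norm H0 E (r_adj z x)"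
        unfolding Hplus_norm_def Hplus_inner_def by (simp add: cinner_self)
      have "cmod (\<Psi> (r_adj z x)) \<le> C * Hplus_norm H0 E (r_adj z x)" by (rule C[OF plus])
      also have "\<dots> \<le> \<bar>C\<bar> * Hplus_norm H0 E (r_adj z x)" by (rule mult_right_mono[OF _ nonneg]) simp
      also have "\<dots> \<le> \<bar>C\<bar> * (K * norm x)" by (intro mult_left_mono K) simp
      finally show ?thesis by (simp add: mult.assoc)
    qed
  qed (rule that)
  have "inv_sqrt_ext H0 E z \<Psi> = h"
    unfolding inv_sqrt_ext_def op_adj_inv_sqrt_op[OF z] op_app_graph
  proof (rule the_equality)
    fix k
    assume "\<forall>x. cinner x k = \<Psi> (r_adj z x)"
    then show "k = h" by (intro cinner_eqI) (simp only: h)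
  qed (simp add: h)
  then have "A_op H0 E V z f = - h"
    by (simp add: A_op_def inv_sqrt_op_eq[OF z] op_app_graph \<Psi>_def)
  then show ?thesis unfolding \<Psi>_def[symmetric] by (simp add: cinner_minus_right h)
qed

text \<open>Both square roots in \<open>A(w)\<close> are \<open>(H0 - z)\<^sup>-\<^sup>1\<^sup>/\<^sup>2 U z w\<close>, one factor \<open>U z w\<close> appearing on either side. This
  carries boundedness and compactness from one point of the resolvent set to all others.\<close>

lemma A_op_transfer:
  assumes V: "bounded_Hplus_Hminus H0 E V" and z: "z \<in> resolvent_set H0" and w: "w \<in> resolvent_set H0"
  shows "A_op H0 E V w f = U z w (A_op H0 E V z (U z w f))"
proof (rule cinner_eqI)
  fix g
  note q = bounded_root_quot[OF w, of z]
  have "r_adj z (bcalc E (\<lambda>t. cnj (root_quot z w t)) g) = r_adj w g"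
    unfolding bcalc_mult[OF bounded_borel_cnj[OF bounded_inv_root[OF z]] bounded_borel_cnj[OF q]]
    by (simp flip: complex_cnj_mult add: inv_root_mult_root_quot[OF z])
  then show "cinner g (A_op H0 E V w f) = cinner g (U z w (A_op H0 E V z (U z w f)))"
    by (simp add: bcalc_adjoint[OF q] cinner_A_op[OF V z] cinner_A_op[OF V w] r_U[OF z w])
qed

end

section \<open>Compact operators\<close>

lemma bounded_clinear_imp_linear: "bounded_clinear T \<Longrightarrow> Vector_Spaces.linear scaleC scaleC T"
  by unfold_locales (simp_all add: bounded_clinearD scaleC_add_right scaleC_add_left scaleC_scaleC scaleC_one)

lemma compact_op_clinear: "compact_op T \<Longrightarrow> bounded_clinear T"
  by (simp add: compact_op_def)

lemma compact_op_conjugate: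
  fixes T S :: "'a::chilbert_space \<Rightarrow> 'a"
  assumes T: "compact_op T" and S: "bounded_clinear S"
  shows "compact_op (\<lambda>x. S (T (S x)))"
  unfolding compact_op_def
proof (intro conjI allI impI)
  show "bounded_clinear (\<lambda>x. S (T (S x)))"
    using bounded_clinear_compose[OF S bounded_clinear_compose[OF compact_op_clinear[OF T] S]] .
  fix B :: "'a set"
  assume "bounded B"
  then have "bounded (S ` B)"
    using S bounded_linear_image unfolding bounded_clinear_def by blast
  then have "compact (closure (T ` S ` B))" using T by (simp add: compact_op_def)
  moreover have "continuous_on X S" for X
    using S unfolding bounded_clinear_def by (auto intro: bounded_linear.continuous_on continuous_on_id)
  ultimately have K: "compact (S ` closure (T ` S ` B))" by (intro compact_continuous_image)
  have "(\<lambda>x. S (T (S x))) ` B \<subseteq> S ` closure (T ` S ` B)"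
    using closure_subset by fastforce
  then have "closure ((\<lambda>x. S (T (S x))) ` B) \<subseteq> S ` closure (T ` S ` B)"
    by (rule closure_minimal[OF _ compact_imp_closed[OF K]])
  then show "compact (closure ((\<lambda>x. S (T (S x))) ` B))"
    using compact_Int_closed[OF K closed_closure] by (metis Int_absorb1)
qed

definition orthonormal :: "'a::chilbert_space set \<Rightarrow> bool" where
  "orthonormal B \<longleftrightarrow> (\<forall>x\<in>B. \<forall>y\<in>B. cinner x y = (if x = y then 1 else 0))"

text \<open>One step of the Gram-Schmidt process.\<close>

lemma orthonormal_extend:
  assumes B: "finite B" "orthonormal B" "B \<subseteq> N" and N: "complex_vector.subspace N"
    and x: "x \<in> N" "x \<notin> cspan B"
  obtains e where "e \<in> N" "e \<notin> B" "orthonormal (insert e B)"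
proof -
  define p where "p = (\<Sum>b\<in>B. cinner b x *\<^sub>C b)"
  define y where "y = x - p"
  have p: "p \<in> cspan B" unfolding p_def
    by (intro complex_vector.span_sum complex_vector.span_scale complex_vector.span_base)
  have "p \<in> N" using p B(3) N complex_vector.span_minimal by blast
  then have yN: "y \<in> N" unfolding y_def using N x(1) complex_vector.subspace_diff by blast
  have "y \<noteq> 0" using p x(2) by (auto simp: y_def)
  have orth: "cinner b y = 0" if "b \<in> B" for b
  proof -
    have "cinner b p = (\<Sum>c\<in>B. cinner c x * (if b = c then 1 else 0))"
      unfolding p_def cinner_sum_right cinner_scaleC_right
      using B(2) that by (intro sum.cong) (auto simp: orthonormal_def)
    also have "\<dots> = cinner b x" using B(1) that by (simp add: if_distrib cong: if_cong)
    finally show ?thesis by (simp add: y_def cinner_diff_right)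
  qed
  define e where "e = complex_of_real (1 / norm y) *\<^sub>C y"
  have "e \<in> N" unfolding e_def using N yN complex_vector.subspace_scale by blast
  have ee: "cinner e e = 1"
    using \<open>y \<noteq> 0\<close> by (simp add: e_def cinner_scaleC_left cinner_scaleC_right cinner_self power2_eq_square
        norm_scaleC norm_divide)
  have be: "cinner b e = 0" "cinner e b = 0" if "b \<in> B" for b
    using orth[OF that] cinner_commute[of y b] by (simp_all add: e_def cinner_scaleC_left cinner_scaleC_right)
  have "e \<notin> B" using ee be by force
  moreover have "orthonormal (insert e B)"
    using B(2) ee be by (auto simp: orthonormal_def)
  ultimately show ?thesis using that \<open>e \<in> N\<close> by blast
qed

lemma orthonormal_exists:
  assumes N: "complex_vector.subspace N" and inf: "\<not> finite_cdim N"
  shows "\<exists>B. finite B \<and> card B = n \<and> B \<subseteq> N \<and> orthonormal B"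
proof (induction n)
  case (Suc n)
  then obtain B where B: "finite B" "card B = n" "B \<subseteq> N" "orthonormal B" by blast
  then obtain x where "x \<in> N" "x \<notin> cspan B" using inf unfolding finite_cdim_def by blast
  then obtain e where "e \<in> N" "e \<notin> B" "orthonormal (insert e B)"
    using orthonormal_extend[OF B(1,4,3) N] by blast
  then show ?case using B by (intro exI[of _ "insert e B"]) simp
qed (auto simp: orthonormal_def intro: exI[of _ "{}"])

text \<open>In infinite dimension there are orthonormal sets of every finite size, whose points have mutual
  distance \<open>\<surd>2\<close>. A cover of the unit ball by finitely many balls of radius \<open>1/2\<close> limits the size of such a set.\<close>

lemma finite_cdim_if_compact_ball:
  assumes N: "complex_vector.subspace N" and K: "compact K" "\<And>x. x \<in> N \<Longrightarrow> norm x \<le> 1 \<Longrightarrow> x \<in> K"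
  shows "finite_cdim N"
proof (rule ccontr)
  assume inf: "\<not> finite_cdim N"
  obtain C where C: "finite C" "K \<subseteq> (\<Union>c\<in>C. ball c (1/2))"
    using K(1) unfolding compact_eq_totally_bounded by (metis zero_less_divide_1_iff zero_less_numeral)
  obtain B where B: "finite B" "card B = Suc (card C)" "B \<subseteq> N" "orthonormal B"
    using orthonormal_exists[OF N inf] by blast
  have norm_B: "norm b = 1" if "b \<in> B" for b
    using B(4) that by (simp add: orthonormal_def norm_eq_sqrt_cinner)
  have "\<exists>c\<in>C. dist c b < 1/2" if "b \<in> B" for b
    using K(2)[of b] C(2) B(3) norm_B that by fastforce
  then obtain c where c: "\<And>b. b \<in> B \<Longrightarrow> c b \<in> C \<and> dist (c b) b < 1/2" by metis
  have "\<not> inj_on c B"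
    using card_inj_on_le[of c B C] c C(1) B(2) by auto
  then obtain x y where xy: "x \<in> B" "y \<in> B" "x \<noteq> y" "c x = c y" unfolding inj_on_def by blast
  have "norm (x - y) < 1"
    using c[OF xy(1)] c[OF xy(2)] xy(4) dist_triangle3[of x y "c x"] by (simp add: dist_norm)
  then have "(norm (x - y))\<^sup>2 < 1" by (simp add: power_less_one_iff)
  moreover have "(norm (x - y))\<^sup>2 = 2"
    using B(4) xy norm_B by (simp add: norm_diff_sq orthonormal_def)
  ultimately show False by simp
qed

lemma subspace_fixed_points:
  "bounded_clinear A \<Longrightarrow> complex_vector.subspace {x. A x = x}"
  by (simp add: complex_vector.subspace_def bounded_clinearD)

lemma finite_cdim_fixed_points:
  assumes "compact_op A"
  shows "finite_cdim {x. A x = x}"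
proof (rule finite_cdim_if_compact_ball)
  show "compact (closure (A ` cball 0 1))" using assms by (simp add: compact_op_def)
  show "x \<in> closure (A ` cball 0 1)" if "x \<in> {x. A x = x}" "norm x \<le> 1" for x
    using that by (intro closure_subset[THEN subsetD] image_eqI[of _ _ x]) auto
qed (rule subspace_fixed_points[OF compact_op_clinear[OF assms]])

text \<open>If no such constant exists, there are unit vectors \<open>x\<^sub>n\<close> with \<open>x\<^sub>n - A x\<^sub>n \<rightarrow> 0\<close>; by compactness they accumulate
  at a unit vector, which is fixed by \<open>A\<close>.\<close>

lemma compact_op_bounded_below:
  assumes A: "compact_op A" and inj: "\<And>x. A x = x \<Longrightarrow> x = 0"
  obtains c where "0 < c" "\<And>x. norm x \<le> c * norm (x - A x)"
proof -
  note lin = bounded_clinearD[OF compact_op_clinear[OF A]]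
  have "\<exists>n::nat. \<forall>x. norm x \<le> real (Suc n) * norm (x - A x)"
  proof (rule ccontr)
    assume "\<not> ?thesis"
    then obtain X where X: "\<And>n. real (Suc n) * norm (X n - A (X n)) < norm (X n)"
      by (metis not_le)
    define Y where "Y n = complex_of_real (1 / norm (X n)) *\<^sub>C X n" for n
    have pos: "0 < norm (X n)" for n
      using X[of n] by (smt (verit) mult_nonneg_nonneg norm_ge_zero of_nat_0_le_iff)
    have Y1: "norm (Y n) = 1" for n using pos[of n] by (simp add: Y_def norm_scaleC norm_divide)
    have Y0: "norm (Y n - A (Y n)) \<le> inverse (real (Suc n))" for n
    proof -
      have "Y n - A (Y n) = complex_of_real (1 / norm (X n)) *\<^sub>C (X n - A (X n))"
        by (simp add: Y_def lin complex_vector.scale_right_diff_distrib)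
      then have "norm (Y n - A (Y n)) = norm (X n - A (X n)) / norm (X n)"
        by (simp add: norm_scaleC norm_divide)
      also have "\<dots> \<le> inverse (real (Suc n))"
        using X[of n] pos[of n] by (simp add: field_simps)
      finally show ?thesis .
    qed
    have "bounded (range Y)" using Y1 by (auto simp: bounded_iff)
    then have "compact (closure (A ` range Y))" using A by (simp add: compact_op_def)
    moreover have "A (Y n) \<in> closure (A ` range Y)" for n
      using closure_subset by fastforce
    ultimately have "\<exists>y\<in>closure (A ` range Y). \<exists>s. strict_mono s \<and> ((\<lambda>n. A (Y n)) \<circ> s) \<longlonglongrightarrow> y"
      unfolding compact_def by (elim allE[of _ "\<lambda>n. A (Y n)"]) simp
    then obtain y s where s: "strict_mono (s :: nat \<Rightarrow> nat)" "(\<lambda>n. A (Y (s n))) \<longlonglongrightarrow> y"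
      by (auto simp: comp_def)
    have "(\<lambda>n. Y n - A (Y n)) \<longlonglongrightarrow> 0"
      by (rule Lim_null_comparison[OF always_eventually LIMSEQ_inverse_real_of_nat]) (use Y0 in blast)
    from LIMSEQ_subseq_LIMSEQ[OF this s(1)] have "(\<lambda>n. Y (s n) - A (Y (s n))) \<longlonglongrightarrow> 0"
      by (simp add: comp_def)
    from tendsto_add[OF this s(2)] have Y: "(\<lambda>n. Y (s n)) \<longlonglongrightarrow> y" by simp
    have "A y = y"
      using LIMSEQ_unique[OF bounded_clinear_tendsto[OF compact_op_clinear[OF A] Y] s(2)] .
    moreover have "norm y = 1"
      using LIMSEQ_unique[OF tendsto_norm[OF Y]] Y1 by simp
    ultimately show False using inj[of y] by simp
  qed
  then obtain n where "\<And>x. norm x \<le> real (Suc n) * norm (x - A x)" by blast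
  then show ?thesis using that[of "real (Suc n)"] by simp
qed

text \<open>The resolvent set is defined through \<open>A - 1\<close>; the sign is moved into the inverse once and for all.\<close>

lemma one_mem_resolvent_graph_iff:
  fixes A :: "'a::chilbert_space \<Rightarrow> 'a"
  shows "1 \<in> resolvent_set (graph A) \<longleftrightarrow> (\<exists>C. bounded_clinear C \<and> (\<forall>f h. f - A f = h \<longleftrightarrow> f = C h))"
proof -
  have shift: "(f, h) \<in> op_shift (graph A) 1 \<longleftrightarrow> f - A f = - h" for f h
    by (auto simp: mem_op_shift_iff graph_def scaleC_one algebra_simps)
  have neg: "bounded_clinear (\<lambda>x. C (- x))" if C: "bounded_clinear C" for C :: "'a \<Rightarrow> 'a"
  proof -
    obtain K where "\<And>x. norm (C x) \<le> K * norm x" using bounded_clinear_bound[OF C] by blast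
    then have "norm (C (- x)) \<le> K * norm x" for x by (metis norm_minus_cancel)
    then show ?thesis
      by (intro bounded_clinearI[where C = K])
        (simp_all add: bounded_clinearD[OF C] complex_vector.scale_minus_right)
  qed
  show ?thesis
    unfolding resolvent_set_def op_inv_eq_graph_iff mem_Collect_eq shift
  proof safe
    fix B assume B: "bounded_clinear B" "\<forall>f h. f - A f = - h \<longleftrightarrow> f = B h"
    have "f - A f = h \<longleftrightarrow> f = B (- h)" for f h using B(2)[rule_format, of f "- h"] by simp
    with neg[OF B(1)] show "\<exists>C. bounded_clinear C \<and> (\<forall>f h. f - A f = h \<longleftrightarrow> f = C h)" by blast
  next
    fix C assume C: "bounded_clinear C" "\<forall>f h. f - A f = h \<longleftrightarrow> f = C h"
    have "f - A f = - h \<longleftrightarrow> f = C (- h)" for f h using C(2) by blast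
    with neg[OF C(1)] show "\<exists>B. bounded_clinear B \<and> (\<forall>f h. f - A f = - h \<longleftrightarrow> f = B h)" by blast
  qed
qed

lemma one_mem_resolventI:
  assumes A: "bounded_clinear A" and below: "\<And>x. norm x \<le> c * norm (x - A x)"
    and surj: "\<And>h. \<exists>f. f - A f = h"
  shows "1 \<in> resolvent_set (graph A)"
proof -
  note lin = bounded_clinearD[OF A]
  obtain C where C: "\<And>h. C h - A (C h) = h" using surj by metis
  have inj: "f = g" if "f - A f = g - A g" for f g
    using below[of "f - g"] that by (simp add: lin algebra_simps)
  have "bounded_clinear C"
  proof (rule bounded_clinearI[where C = c])
    show "C (x + y) = C x + C y" for x y
      by (rule inj) (simp add: C lin, metis C add_diff_add)
    show "C (k *\<^sub>C x) = k *\<^sub>C C x" for k x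
    proof (rule inj)
      have "k *\<^sub>C C x - A (k *\<^sub>C C x) = k *\<^sub>C (C x - A (C x))"
        by (simp add: lin complex_vector.scale_right_diff_distrib)
      then show "C (k *\<^sub>C x) - A (C (k *\<^sub>C x)) = k *\<^sub>C C x - A (k *\<^sub>C C x)" by (simp add: C)
    qed
    show "norm (C x) \<le> c * norm x" for x using below[of "C x"] by (simp add: C)
  qed
  moreover have "f - A f = h \<longleftrightarrow> f = C h" for f h using C inj by metis
  ultimately show ?thesis unfolding one_mem_resolvent_graph_iff by blast
qed

text \<open>The operator \<open>1 - A\<close> is bounded below, so its range is closed; being dense, the range is everything.\<close>

lemma one_mem_resolvent_if_dense:
  assumes A: "compact_op A" and inj: "\<And>x. A x = x \<Longrightarrow> x = 0"
    and dense: "\<And>h. \<exists>F. (\<lambda>n. F n - A (F n)) \<longlonglongrightarrow> h"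
  shows "1 \<in> resolvent_set (graph A)"
proof -
  note lin = bounded_clinearD[OF compact_op_clinear[OF A]]
  obtain c where c: "0 < c" "\<And>x. norm x \<le> c * norm (x - A x)"
    using compact_op_bounded_below[OF A inj] by blast
  have "\<exists>f. f - A f = h" for h
  proof -
    obtain F where F: "(\<lambda>n. F n - A (F n)) \<longlonglongrightarrow> h" using dense by blast
    have "Cauchy F"
    proof (rule metric_CauchyI)
      fix e :: real assume "0 < e"
      then have "0 < e / c" using c(1) by simp
      then obtain M where M: "\<And>m n. M \<le> m \<Longrightarrow> M \<le> n \<Longrightarrow>
          dist (F m - A (F m)) (F n - A (F n)) < e / c"
        using metric_CauchyD[OF LIMSEQ_imp_Cauchy[OF F]] by blast
      have "dist (F m) (F n) < e" if "M \<le> m" "M \<le> n" for m n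
      proof -
        have "norm (F m - F n) \<le> c * norm ((F m - A (F m)) - (F n - A (F n)))"
          using c(2)[of "F m - F n"] by (simp add: lin algebra_simps)
        also have "\<dots> < c * (e / c)"
          using M[OF that] c(1) by (intro mult_strict_left_mono) (simp_all add: dist_norm)
        finally show ?thesis using c(1) by (simp add: dist_norm)
      qed
      then show "\<exists>M. \<forall>m\<ge>M. \<forall>n\<ge>M. dist (F m) (F n) < e" by blast
    qed
    then obtain f where f: "F \<longlonglongrightarrow> f" using Cauchy_convergent convergent_def by blast
    have "(\<lambda>n. F n - A (F n)) \<longlonglongrightarrow> f - A f"
      by (intro tendsto_diff f bounded_clinear_tendsto[OF compact_op_clinear[OF A]])
    then show ?thesis using LIMSEQ_unique[OF F] by blast
  qed
  then show ?thesis by (rule one_mem_resolventI[OF compact_op_clinear[OF A] c(2)])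
qed

text \<open>Solutions of \<open>f = h + A f\<close> come from the Banach fixed point theorem.\<close>

lemma one_mem_resolvent_if_contraction:
  assumes A: "bounded_clinear A" and small: "onorm A < 1"
  shows "1 \<in> resolvent_set (graph A)"
proof -
  note lin = bounded_clinearD[OF A]
  have bl: "bounded_linear A" using A by (simp add: bounded_clinear_def)
  define q where "q = onorm A"
  have q: "0 \<le> q" "q < 1" using small onorm_pos_le[OF bl] by (auto simp: q_def)
  have le: "norm (A x) \<le> q * norm x" for x unfolding q_def by (rule onorm[OF bl])
  show ?thesis
  proof (rule one_mem_resolventI[OF A])
    show "norm x \<le> 1 / (1 - q) * norm (x - A x)" for x
    proof -
      have "norm x \<le> norm (x - A x) + q * norm x"
        using norm_triangle_ineq[of "x - A x" "A x"] le[of x] by simp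
      then have "(1 - q) * norm x \<le> norm (x - A x)" by (simp add: algebra_simps)
      then show ?thesis using q by (simp add: field_simps)
    qed
    show "\<exists>f. f - A f = h" for h
    proof -
      have "\<forall>x y. dist (h + A x) (h + A y) \<le> q * dist x y"
        using le by (simp add: dist_norm flip: lin(3))
      then have "\<exists>!f. h + A f = f"
        using q by (intro banach_fix_type) auto
      then show ?thesis by (metis add_diff_cancel_right')
    qed
  qed
qed

lemma
  assumes T: "bounded_clinear T" and inj: "\<And>x y. T x = T y \<Longrightarrow> x = y"
  shows cdim_image_inj: "cdim (T ` N) = cdim N"
    and finite_cdim_image: "finite_cdim N \<Longrightarrow> finite_cdim (T ` N)"
proof -
  interpret vector_space_pair "scaleC :: complex \<Rightarrow> 'a \<Rightarrow> 'a" "scaleC :: complex \<Rightarrow> 'b \<Rightarrow> 'b"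
    by unfold_locales
  note lin = bounded_clinear_imp_linear[OF T]
  obtain B where B: "B \<subseteq> N" "complex_vector.independent B" "N \<subseteq> cspan B" "card B = cdim N"
    using complex_vector.basis_exists by blast
  have inj_on: "inj_on T X" for X using inj by (auto intro: inj_onI)
  show "cdim (T ` N) = cdim N"
  proof (rule complex_vector.dim_unique)
    show "T ` B \<subseteq> T ` N" using B by blast
    show "T ` N \<subseteq> cspan (T ` B)" using B(3) linear_span_image[OF lin, folded cspan_def] by blast
    show "complex_vector.independent (T ` B)"
      using linear_independent_injective_image[OF lin B(2) inj_on] .
    show "card (T ` B) = cdim N" using card_image[OF inj_on] B(4) by simp
  qed
  show "finite_cdim (T ` N)" if N: "finite_cdim N"
  proof -
    obtain B where "finite B" "N \<subseteq> cspan B" using N by (auto simp: finite_cdim_def)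
    then show ?thesis unfolding finite_cdim_def
      using linear_span_image[OF lin, folded cspan_def, of B] by (intro exI[of _ "T ` B"]) auto
  qed
qed

section \<open>Eigenvalues of \<open>H\<close> and of \<open>A(z)\<close>\<close>

context operator_calculus
begin

text \<open>The resolvent identity at a single point \<open>e\<close> describes \<open>H - w\<close> for every \<open>w\<close> in the resolvent
  set of \<open>H0\<close>: substitute \<open>k = U e w g\<close> in \<open>k - A(e) k = r e (h + (w - e) f)\<close>, apply \<open>U e w\<close>, and cancel the two
  terms \<open>(w - e) r w (r w g)\<close>, one from \<open>U e w (U e w g)\<close>, the other from \<open>(w - e) f\<close>.\<close>

lemma mem_op_shift_H_iff:
  assumes V: "bounded_Hplus_Hminus H0 E V"
    and e: "e \<in> resolvent_set H0" and w: "w \<in> resolvent_set H0"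
    and H: "op_inv (op_shift H e) = op_comp (inv_sqrt_op H0 E e)
      (op_comp (op_inv (graph (\<lambda>x. x - A_op H0 E V e x))) (inv_sqrt_op H0 E e))"
  shows "(f, h) \<in> op_shift H w \<longleftrightarrow> (\<exists>g. f = r w g \<and> g - A_op H0 E V w g = r w h)"
proof -
  let ?A = "A_op H0 E V" and ?k = "h + (w - e) *\<^sub>C f"
  note lin = bounded_clinearD[OF bcalc_clinear[OF bounded_root_quot[OF w, of e]]]
    bounded_clinearD[OF bcalc_clinear[OF bounded_inv_root[OF e]]]
  have "(f, h) \<in> op_shift H w \<longleftrightarrow> (?k, f) \<in> op_inv (op_shift H e)"
    by (simp add: op_inv_def mem_op_shift_iff scaleC_add_left[symmetric] add.assoc)
  also have "\<dots> \<longleftrightarrow> (\<exists>k. k - ?A e k = r e ?k \<and> f = r e k)"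
    unfolding H inv_sqrt_op_eq[OF e] by (auto simp: op_comp_def op_inv_def graph_def)
  also have "\<dots> \<longleftrightarrow> (\<exists>g. U e w g - ?A e (U e w g) = r e ?k \<and> f = r e (U e w g))"
    using U_inverse[OF e w] by metis
  also have "\<dots> \<longleftrightarrow> (\<exists>g. f = r w g \<and> g - ?A w g = r w h)"
  proof -
    have "U e w g - ?A e (U e w g) = r e ?k \<longleftrightarrow> g - ?A w g = r w h" if f: "f = r w g" for g
    proof -
      have inj: "U e w x = U e w y \<longleftrightarrow> x = y" for x y
        using U_inverse[OF w e] by metis
      have "U e w g - ?A e (U e w g) = r e ?k \<longleftrightarrow>
          U e w (U e w g) - U e w (?A e (U e w g)) = U e w (r e ?k)"
        by (simp only: inj flip: lin(3))
      also have "U e w (U e w g) - U e w (?A e (U e w g)) = (w - e) *\<^sub>C r w f + (g - ?A w g)"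
        by (simp add: U_U[OF e w] A_op_transfer[OF V e w] f)
      also have "U e w (r e ?k) = (w - e) *\<^sub>C r w f + r w h"
        by (simp add: lin r_U[OF e w])
      finally show ?thesis by simp
    qed
    then show ?thesis by (auto simp: r_U[OF e w])
  qed
  finally show ?thesis .
qed

end

theorem theorem2p10:
  fixes H0 H :: "'a::chilbert_space operator"
    and E :: "real \<Rightarrow> 'a \<Rightarrow> 'a"
    and V :: "'a \<Rightarrow> 'a \<Rightarrow> complex"
    and lam0 :: complex
  defines "A \<equiv> A_op H0 E V"
    and "R \<equiv> inv_sqrt_op H0 E"
  assumes separable: "separable_space (euclidean :: 'a topology)"
    and H0_self_adjoint: "self_adjoint H0"
    and H0_nonneg: "nonneg_op H0"
    and E_spectral: "spectral_family_of E H0"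
    and V_bounded: "bounded_Hplus_Hminus H0 E V"
    and A_compact: "\<exists>z \<in> resolvent_set H0. compact_op (A z)"
    and A_small: "\<exists>E\<^sub>0::real. E\<^sub>0 < 0 \<and> onorm (A (complex_of_real E\<^sub>0)) < 1"
    and H_op: "linear_op H" "densely_defined H" "closed H"
    and H_resolvent: "\<And>z. z \<in> resolvent_set H0 \<Longrightarrow> 1 \<in> resolvent_set (graph (A z)) \<Longrightarrow>
          op_inv (op_shift H z) =
            op_comp (R z) (op_comp (op_inv (graph (\<lambda>x. x - A z x))) (R z))"
    and lam0: "lam0 \<in> resolvent_set H0"
  shows
    "(\<forall>f. f \<noteq> 0 \<longrightarrow> (f, lam0 *\<^sub>C f) \<in> H \<longrightarrow>
        f \<in> Domain (sqrt_op H0 E lam0) \<and>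
        op_app (sqrt_op H0 E lam0) f \<noteq> 0 \<and>
        A lam0 (op_app (sqrt_op H0 E lam0) f) = op_app (sqrt_op H0 E lam0) f) \<and>
     (\<forall>g. g \<noteq> 0 \<longrightarrow> A lam0 g = g \<longrightarrow>
        g \<in> Domain (R lam0) \<and> op_app (R lam0) g \<noteq> 0 \<and>
        (op_app (R lam0) g, lam0 *\<^sub>C op_app (R lam0) g) \<in> H) \<and>
     finite_cdim (op_ker (op_shift H lam0)) \<and>
     finite_cdim (op_ker (graph (\<lambda>x. x - A lam0 x))) \<and>
     cdim (op_ker (op_shift H lam0)) = cdim (op_ker (graph (\<lambda>x. x - A lam0 x))) \<and>
     geometric_multiplicity H lam0 = geometric_multiplicity (graph (A lam0)) 1 \<and>
     (\<forall>z \<in> resolvent_set H0. z \<in> resolvent_set H \<longleftrightarrow> 1 \<in> resolvent_set (graph (A z)))"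
proof -
  interpret operator_calculus E H0
    using E_spectral unfolding spectral_family_of_def
    by unfold_locales simp_all
  obtain z0 where z0: "z0 \<in> resolvent_set H0" "compact_op (A z0)" using A_compact by blast
  have compact_A: "compact_op (A w)" if "w \<in> resolvent_set H0" for w
  proof -
    have "A w = (\<lambda>f. U z0 w (A z0 (U z0 w f)))"
      unfolding A_def using A_op_transfer[OF V_bounded z0(1) that] by blast
    then show ?thesis
      using compact_op_conjugate[OF z0(2) bcalc_clinear[OF bounded_root_quot[OF that]]] by simp
  qed
  obtain E\<^sub>0 :: real where E\<^sub>0: "E\<^sub>0 < 0" "onorm (A (complex_of_real E\<^sub>0)) < 1" using A_small by blast
  have e: "complex_of_real E\<^sub>0 \<in> resolvent_set H0"
    by (rule negative_mem_resolvent[OF H0_nonneg E\<^sub>0(1)])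
  have "1 \<in> resolvent_set (graph (A (complex_of_real E\<^sub>0)))"
    by (rule one_mem_resolvent_if_contraction[OF compact_op_clinear[OF compact_A[OF e]] E\<^sub>0(2)])
  note H_e = H_resolvent[OF e this, unfolded A_def R_def]
  have key: "(f, h) \<in> op_shift H w \<longleftrightarrow> (\<exists>g. f = r w g \<and> g - A w g = r w h)"
    if "w \<in> resolvent_set H0" for w f h
    unfolding A_def by (rule mem_op_shift_H_iff[OF V_bounded e that H_e])
  have r_lin: "bounded_clinear (r w)" if "w \<in> resolvent_set H0" for w
    by (rule bcalc_clinear[OF bounded_inv_root[OF that]])
  have r_zero: "r w 0 = 0" if "w \<in> resolvent_set H0" for w
    by (rule bounded_clinearD(4)[OF r_lin[OF that]])
  have eigen: "(f, lam0 *\<^sub>C f) \<in> H \<longleftrightarrow> (\<exists>g. f = r lam0 g \<and> A lam0 g = g)" for f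
    using key[OF lam0, of f 0] by (auto simp: mem_op_shift_iff r_zero[OF lam0])
  have ker_H: "op_ker (op_shift H lam0) = r lam0 ` {g. A lam0 g = g}"
    using eigen by (auto simp: op_ker_def mem_op_shift_iff)
  have ker_A: "op_ker (graph (\<lambda>x. x - A lam0 x)) = {g. A lam0 g = g}"
    "op_ker (op_shift (graph (A lam0)) 1) = {g. A lam0 g = g}"
    by (auto simp: op_ker_def graph_def mem_op_shift_iff scaleC_one)
  have fin: "finite_cdim {g. A lam0 g = g}"
    by (rule finite_cdim_fixed_points[OF compact_A[OF lam0]])
  note image = cdim_image_inj[OF r_lin[OF lam0] r_inj[OF lam0]]
    finite_cdim_image[OF r_lin[OF lam0] r_inj[OF lam0]]
  have "f \<in> Domain (sqrt_op H0 E lam0) \<and> op_app (sqrt_op H0 E lam0) f \<noteq> 0 \<and>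
      A lam0 (op_app (sqrt_op H0 E lam0) f) = op_app (sqrt_op H0 E lam0) f"
    if f: "f \<noteq> 0" "(f, lam0 *\<^sub>C f) \<in> H" for f
  proof -
    obtain g where g: "f = r lam0 g" "A lam0 g = g" using f(2) eigen by blast
    then have mem: "(f, g) \<in> sqrt_op H0 E lam0" by (simp add: mem_sqrt_op_iff[OF lam0])
    have "g \<noteq> 0" using f(1) g(1) r_zero[OF lam0] by auto
    with mem g(2) show ?thesis by (auto simp: op_app_sqrt_op[OF mem])
  qed
  moreover have "g \<in> Domain (R lam0) \<and> op_app (R lam0) g \<noteq> 0 \<and>
      (op_app (R lam0) g, lam0 *\<^sub>C op_app (R lam0) g) \<in> H"
    if g: "g \<noteq> 0" "A lam0 g = g" for g
  proof -
    have R: "R lam0 = graph (r lam0)" unfolding R_def by (rule inv_sqrt_op_eq[OF lam0])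
    have "r lam0 g \<noteq> 0" using r_inj[OF lam0, of g 0] r_zero[OF lam0] g(1) by auto
    moreover have "(r lam0 g, lam0 *\<^sub>C r lam0 g) \<in> H" using eigen g(2) by blast
    ultimately show ?thesis unfolding R op_app_graph by (auto simp: graph_def)
  qed
  moreover have "z \<in> resolvent_set H \<longleftrightarrow> 1 \<in> resolvent_set (graph (A z))"
    if z: "z \<in> resolvent_set H0" for z
  proof
    assume "1 \<in> resolvent_set (graph (A z))"
    then obtain C where C: "bounded_clinear C" "\<And>f h. f - A z f = h \<longleftrightarrow> f = C h"
      unfolding one_mem_resolvent_graph_iff by blast
    have "op_inv (op_shift H z) = graph (\<lambda>h. r z (C (r z h)))"
      unfolding op_inv_eq_graph_iff key[OF z] C(2) by blast
    moreover have "bounded_clinear (\<lambda>h. r z (C (r z h)))"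
      by (intro bounded_clinear_compose[OF r_lin[OF z]] bounded_clinear_compose[OF C(1)] r_lin[OF z])
    ultimately show "z \<in> resolvent_set H" unfolding resolvent_set_def by blast
  next
    assume "z \<in> resolvent_set H"
    then obtain B where B: "bounded_clinear B" "\<And>f h. (f, h) \<in> op_shift H z \<longleftrightarrow> f = B h"
      unfolding resolvent_set_def op_inv_eq_graph_iff by blast
    \<comment> \<open>Surjectivity of \<open>H - z\<close> puts the dense range of \<open>r z\<close> inside the range of \<open>1 - A z\<close>.\<close>
    have range: "\<exists>g. g - A z g = r z h" for h
      using key[OF z, of "B h" h] B(2) by blast
    show "1 \<in> resolvent_set (graph (A z))"
    proof (rule one_mem_resolvent_if_dense[OF compact_A[OF z]])
      fix g
      assume "A z g = g"
      then have "(r z g, 0) \<in> op_shift H z"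
        unfolding key[OF z] by (intro exI[of _ g]) (simp add: r_zero[OF z])
      then have "r z g = r z 0" by (simp add: B(2) bounded_clinearD(4)[OF B(1)] r_zero[OF z])
      then show "g = 0" by (rule r_inj[OF z])
    next
      fix h
      obtain X where X: "(\<lambda>n. r z (X n)) \<longlonglongrightarrow> h" using r_range_dense[OF z] by blast
      have "\<forall>n. \<exists>g. g - A z g = r z (X n)" using range by blast
      from choice[OF this] obtain F where "\<forall>n. F n - A z (F n) = r z (X n)" by blast
      with X show "\<exists>F. (\<lambda>n. F n - A z (F n)) \<longlonglongrightarrow> h" by (intro exI[of _ F]) simp
    qed
  qed
  ultimately show ?thesis
    using fin image by (simp add: ker_H ker_A geometric_multiplicity_def)
qed

end
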